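(* Let $g,h\in\mathbb{R}$ with $h\neq 0$, let $N\geq 1$, and let $v:\mathbb{Z}\to\mathbb{R}$ be bounded with $\lim_{n\to\pm\infty}v(n)=0$. Then the self-adjoint operator $H^{(N)}$ on $\ell^2(\mathbb{Z}^N)$ has pure point spectrum, i.e. $\ell^2(\mathbb{Z}^N)$ is spanned (as a closed linear span) by eigenvectors of $H^{(N)}$.
   Context: Let $(e_j)_{j\in\mathbb{Z}}$ be the canonical basis of $\ell^2(\mathbb{Z})$, $Xe_j=je_j$, $\Delta e_j=-(e_{j-1}+e_{j+1})$, and $H_0=g\Delta-2hX$, self-adjoint on the domain of $X$. On $\ell^2(\mathbb{Z}^N)=\bigotimes_{k=1}^N\ell^2(\mathbb{Z})$, with position basis $|x_1,\dots,x_N\rangle=e_{x_1}\otimes\cdots\otimes e_{x_N}$, let $H_0^{(N)}=\sum_{k=1}^N 1\otimes\cdots\otimes H_0\otimes\cdots\otimes 1$ ($H_0$ in the $k$-th factor; self-adjoint closure), and $H^{(N)}=H_0^{(N)}+\sum_{1\le i<j\le N}V_{ij}$, where $V_{ij}$ is the bounded operator of multiplication by $v(x_i-x_j)$ in the position basis. *)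

theory Defs
  imports "HOL-Analysis.Analysis"
begin

text \<open>Configurations of N particles on the lattice: points of Z^N, encoded as
  functions nat => int that vanish at indices k >= N (coordinates x 0, ..., x (N-1)).\<close>
definition config :: "nat \<Rightarrow> (nat \<Rightarrow> int) set" where
  "config N = {x. \<forall>k\<ge>N. x k = 0}"

definition ell2 :: "nat \<Rightarrow> ((nat \<Rightarrow> int) \<Rightarrow> complex) set" where
  "ell2 N = {\<psi>. (\<forall>x. x \<notin> config N \<longrightarrow> \<psi> x = 0) \<and>
                 (\<lambda>x. (cmod (\<psi> x))\<^sup>2) summable_on UNIV}"

definition ell2_norm :: "((nat \<Rightarrow> int) \<Rightarrow> complex) \<Rightarrow> real" where
  "ell2_norm \<psi> = sqrt (\<Sum>\<^sub>\<infinity>x. (cmod (\<psi> x))\<^sup>2)"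

text \<open>Domain of the self-adjoint closure of H_0^(N): since Delta is bounded,
  it is the maximal domain of multiplication by x_1 + ... + x_N.\<close>
definition domH :: "nat \<Rightarrow> ((nat \<Rightarrow> int) \<Rightarrow> complex) set" where
  "domH N = {\<psi> \<in> ell2 N. (\<lambda>x. of_int (\<Sum>k<N. x k) * \<psi> x) \<in> ell2 N}"

text \<open>Action of H^(N) = sum_k (g Delta_k - 2 h X_k) + sum_{i<j} v(x_i - x_j), with
  (Delta e_j) = -(e_{j-1} + e_{j+1}).\<close>
definition Hop :: "real \<Rightarrow> real \<Rightarrow> (int \<Rightarrow> real) \<Rightarrow> nat \<Rightarrow>
    ((nat \<Rightarrow> int) \<Rightarrow> complex) \<Rightarrow> (nat \<Rightarrow> int) \<Rightarrow> complex" where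
  "Hop g h v N \<psi> x =
     (if x \<in> config N then
        (\<Sum>k<N. - of_real g * (\<psi> (x(k := x k - 1)) + \<psi> (x(k := x k + 1))))
        - of_real (2 * h) * of_int (\<Sum>k<N. x k) * \<psi> x
        + (\<Sum>i<N. \<Sum>j\<in>{i<..<N}. of_real (v (x i - x j))) * \<psi> x
      else 0)"

definition eigenvector :: "real \<Rightarrow> real \<Rightarrow> (int \<Rightarrow> real) \<Rightarrow> nat \<Rightarrow>
    ((nat \<Rightarrow> int) \<Rightarrow> complex) \<Rightarrow> bool" where
  "eigenvector g h v N \<psi> \<longleftrightarrow> \<psi> \<in> domH N \<and> \<psi> \<noteq> (\<lambda>_. 0) \<and>
     (\<exists>\<mu>::complex. \<forall>x. Hop g h v N \<psi> x = \<mu> * \<psi> x)"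

definition pure_point :: "real \<Rightarrow> real \<Rightarrow> (int \<Rightarrow> real) \<Rightarrow> nat \<Rightarrow> bool" where
  "pure_point g h v N \<longleftrightarrow>
     (\<forall>\<phi>\<in>ell2 N. \<forall>\<epsilon>>0. \<exists>F c. finite F \<and> (\<forall>\<psi>\<in>F. eigenvector g h v N \<psi>) \<and>
        ell2_norm (\<lambda>x. \<phi> x - (\<Sum>\<psi>\<in>F. c \<psi> * \<psi> x)) < \<epsilon>)"

end

theory Submission
  imports Defs
begin

text \<open>
  The operator is real, so everything happens in a real Hilbert space of square-summable
  functions. Call \<open>t\<close> regular when \<open>H - t\<close> is bounded below; a self-adjoint operator with only
  countably many non-regular points has a total set of eigenvectors, because on the orthogonal
  complement of the eigenvectors the closed countable spectrum would have an isolated point, and an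
  isolated point of the spectrum is an eigenvalue.

  That the spectrum of the \<open>N\<close>-body operator is countable follows by induction on the set \<open>I\<close> of
  particles. The field term confines \<open>\<Sum>k. x k\<close>, so outside a finite set of configurations either
  this sum is large or the particles split into two distant clusters \<open>C\<close> and \<open>I - C\<close>. Cutoffs to
  the latter regions show that if \<open>t\<close> is regular for all the decoupled operators
  \<open>H\<^sub>C \<otimes> 1 + 1 \<otimes> H\<^sub>I\<^sub>-\<^sub>C\<close>, then \<open>norm u\<close> is controlled by \<open>(H - t) u\<close> and finitely many
  coordinates of \<open>u\<close>, whence \<open>t\<close> is regular or one of the countably many eigenvalues. By
  induction the two cluster operators have total sets of eigenvectors, so the spectrum of the
  decoupled operator lies in the closure of the sums \<open>a + b\<close> of spectral values. These sums already
  form a closed countable set: moving all particles of a cluster by one site shifts \<open>H\<^sub>C\<close> by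
  \<open>2 h |C|\<close>, so both spectra are periodic with the common period \<open>2 h |C| |I - C|\<close>.
\<close>

section \<open>Orthogonal projections\<close>

text \<open>Lower bounds carry the whole spectral theory here. For a self-adjoint graph a lower
  bound for \<open>H - t\<close> already gives an everywhere defined inverse, because the orthogonal
  complement of the range consists of solutions of \<open>H u = t u\<close>. Countability is a
  target that suits a potential decaying without any rate: an error that can merely be made small is
  enough to separate clusters, and what is left over at a given \<open>t\<close> is an eigenvalue.
  The obstacle is the closure of the sums \<open>a + b\<close>. Two countable closed sets can have a
  dense sumset, as the integer multiples of 1 and of the square root of 2 do, and then the induction
  would break down. The field excludes this: the period of a cluster is an integer multiple of
  \<open>2 * h\<close>, so the periods of two clusters are commensurable, and modulo a common period
  one summand can be kept in a compact set. Thus \<open>h \<noteq> 0\<close> matters for this period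
  as well as for confinement.\<close>

lemma closure_subspace:
  fixes M :: "'a::real_normed_vector set"
  assumes "subspace M"
  shows "subspace (closure M)"
proof (rule subspaceI)
  show "0 \<in> closure M"
    using assms closure_subset subspace_0 by blast
next
  fix x y assume "x \<in> closure M" "y \<in> closure M"
  then obtain f k where "\<And>n. f n \<in> M" "f \<longlonglongrightarrow> x" "\<And>n. k n \<in> M" "k \<longlonglongrightarrow> y"
    by (auto simp: closure_sequential)
  then show "x + y \<in> closure M"
    unfolding closure_sequential
    by (intro exI[of _ "\<lambda>n. f n + k n"]) (auto intro: tendsto_add subspace_add[OF assms])
next
  fix c :: real and x assume "x \<in> closure M"
  then obtain f where "\<And>n. f n \<in> M" "f \<longlonglongrightarrow> x"
    by (auto simp: closure_sequential)
  then show "c *\<^sub>R x \<in> closure M"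
    unfolding closure_sequential
    by (intro exI[of _ "\<lambda>n. c *\<^sub>R f n"]) (auto intro: tendsto_scaleR subspace_scale[OF assms])
qed

lemma orthogonal_if_minimal:
  fixes z m :: "'a::real_inner"
  assumes min: "\<And>t. norm z \<le> norm (z - t *\<^sub>R m)"
  shows "inner z m = 0"
proof (cases "m = 0")
  case False
  define t where "t = inner z m / inner m m"
  have pos: "inner m m > 0" using False by simp
  have "(norm z)\<^sup>2 \<le> (norm (z - t *\<^sub>R m))\<^sup>2"
    using min by (intro power_mono) auto
  then have "inner z z \<le> inner (z - t *\<^sub>R m) (z - t *\<^sub>R m)"
    by (simp add: power2_norm_eq_inner)
  also have "\<dots> = inner z z - (inner z m)\<^sup>2 / inner m m"
    using pos by (simp add: inner_diff t_def inner_commute[of m z] power2_eq_square field_simps)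
  finally have "(inner z m)\<^sup>2 / inner m m \<le> 0" by simp
  then show ?thesis using pos by (simp add: divide_le_0_iff)
qed auto

text \<open>A minimizing sequence is Cauchy by the parallelogram identity, since midpoints of
  members of \<open>M\<close> stay in \<open>M\<close> and so are at distance at least
  \<open>d\<close> from \<open>x\<close>.\<close>

lemma orthogonal_projection_exists:
  fixes M :: "'a::{real_inner,complete_space} set"
  assumes M: "subspace M" "closed M"
  shows "\<exists>p\<in>M. \<forall>m\<in>M. inner (x - p) m = 0"
proof -
  define d where "d = infdist x M"
  have ne: "M \<noteq> {}" using M(1) subspace_0 by blast
  have d0: "d \<ge> 0" by (simp add: d_def infdist_nonneg)
  have dle: "d \<le> norm (x - m)" if "m \<in> M" for m
    using infdist_le[OF that, of x] by (simp add: d_def dist_norm)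
  have "\<exists>m\<in>M. norm (x - m) < d + 1 / real (Suc n)" for n
  proof -
    have "infdist x M < d + 1 / real (Suc n)" by (simp add: d_def)
    then show ?thesis
      using ne cInf_lessD[of "dist x ` M"] by (auto simp: infdist_notempty dist_norm)
  qed
  then obtain p where pM: "\<And>n. p n \<in> M" and p: "\<And>n. norm (x - p n) < d + 1 / real (Suc n)"
    by metis
  have sq: "(norm (p m - p n))\<^sup>2 \<le> 4 * (2 * d + 1) / real (Suc N)"
    if "m \<ge> N" "n \<ge> N" for m n N
  proof -
    define e where "e = 1 / real (Suc N)"
    have e: "0 < e" "e \<le> 1" by (auto simp: e_def)
    have le: "norm (x - p k) \<le> d + e" if "k \<ge> N" for k
    proof -
      have "1 / real (Suc k) \<le> e" using that unfolding e_def by (intro divide_left_mono) auto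
      with p[of k] show ?thesis by linarith
    qed
    have mid: "(1/2) *\<^sub>R (p m + p n) \<in> M"
      using M(1) pM by (simp add: subspace_add subspace_scale)
    have "(norm (p m - p n))\<^sup>2 = 2 * (norm (x - p m))\<^sup>2 + 2 * (norm (x - p n))\<^sup>2
        - 4 * (norm (x - (1/2) *\<^sub>R (p m + p n)))\<^sup>2"
      by (simp add: power2_norm_eq_inner inner_diff inner_add inner_commute algebra_simps)
    also have "\<dots> \<le> 2 * (d + e)\<^sup>2 + 2 * (d + e)\<^sup>2 - 4 * d\<^sup>2"
      using le that dle[OF mid] d0
      by (intro diff_mono add_mono mult_left_mono power_mono) auto
    also have "\<dots> = 4 * (2 * d + e) * e" by (simp add: power2_eq_square algebra_simps)
    also have "\<dots> \<le> 4 * (2 * d + 1) * e"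
      using e d0 by (intro mult_right_mono) auto
    finally show ?thesis by (simp add: e_def)
  qed
  have "Cauchy p"
  proof (rule metric_CauchyI)
    fix e :: real assume "e > 0"
    obtain N where N: "4 * (2 * d + 1) / e\<^sup>2 < real N" using reals_Archimedean2 by blast
    then have "4 * (2 * d + 1) < real (Suc N) * e\<^sup>2"
      using \<open>e > 0\<close> by (simp add: field_simps) (smt (verit) zero_le_power2)
    then have lt: "4 * (2 * d + 1) / real (Suc N) < e\<^sup>2"
      by (simp add: divide_less_eq mult.commute)
    show "\<exists>M. \<forall>m\<ge>M. \<forall>n\<ge>M. dist (p m) (p n) < e"
    proof (intro exI[of _ N] allI impI)
      fix m n assume "N \<le> m" "N \<le> n"
      then have "(norm (p m - p n))\<^sup>2 < e\<^sup>2" using sq[of N m n] lt by linarith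
      then show "dist (p m) (p n) < e"
        using \<open>e > 0\<close> by (simp add: dist_norm power_less_imp_less_base)
    qed
  qed
  then obtain q where q: "p \<longlonglongrightarrow> q" using Cauchy_convergent convergent_def by blast
  have qM: "q \<in> M" using M(2) pM q closed_sequentially by blast
  have "norm (x - q) \<le> d"
  proof (rule LIMSEQ_le)
    show "(\<lambda>n. norm (x - p n)) \<longlonglongrightarrow> norm (x - q)" by (intro tendsto_intros q)
    show "(\<lambda>n. d + 1 / real (Suc n)) \<longlonglongrightarrow> d"
      using tendsto_add[OF tendsto_const LIMSEQ_inverse_real_of_nat, of d] by (simp add: inverse_eq_divide)
    show "\<exists>N. \<forall>n\<ge>N. norm (x - p n) \<le> d + 1 / real (Suc n)" using p less_imp_le by blast
  qed
  have "inner (x - q) m = 0" if "m \<in> M" for m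
  proof (rule orthogonal_if_minimal)
    fix t :: real
    have "norm (x - q) \<le> norm (x - (q + t *\<^sub>R m))"
      using \<open>norm (x - q) \<le> d\<close> dle[of "q + t *\<^sub>R m"] M(1) qM that
      by (meson order_trans subspace_add subspace_scale)
    then show "norm (x - q) \<le> norm (x - q - t *\<^sub>R m)" by (simp add: algebra_simps)
  qed
  with qM show ?thesis by blast
qed

text \<open>The working form of the projection theorem: density of \<open>M\<close> in
  \<open>L\<close> is traded for triviality of its orthogonal complement within \<open>L\<close>.
  Ranges, spans of eigenvectors and spans of \<open>delta\<close> functions are all shown dense in
  this way.\<close>

lemma in_closure_if_orthogonal:
  fixes M L :: "'a::{real_inner,complete_space} set"
  assumes "subspace M" "M \<subseteq> L" "subspace L" "closed L" "x \<in> L"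
    and orth: "\<And>z. z \<in> L \<Longrightarrow> (\<And>m. m \<in> M \<Longrightarrow> inner z m = 0) \<Longrightarrow> z = 0"
  shows "x \<in> closure M"
proof -
  obtain p where p: "p \<in> closure M" "\<And>m. m \<in> closure M \<Longrightarrow> inner (x - p) m = 0"
    using orthogonal_projection_exists[OF closure_subspace[OF assms(1)] closed_closure] by blast
  have "p \<in> L" using p(1) assms closure_minimal by blast
  then have "x - p = 0"
    using assms p closure_subset[of M] by (intro orth) (auto intro: subspace_diff)
  then show ?thesis using p(1) by simp
qed

text \<open>Baire category: without isolated points every \<open>S - {x}\<close> would be open and
  dense in \<open>S\<close>, yet these countably many sets have empty intersection.\<close>

lemma countable_closed_has_isolated_point:
  fixes S :: "real set"
  assumes "closed S" "countable S" "S \<noteq> {}"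
  shows "\<exists>x\<in>S. \<exists>r>0. \<forall>y\<in>S. \<bar>y - x\<bar> < r \<longrightarrow> y = x"
proof (rule ccontr)
  assume neg: "\<not> ?thesis"
  have "S \<subseteq> closure (\<Inter>((\<lambda>x. S - {x}) ` S))"
  proof (rule Baire[OF assms(1)])
    show "countable ((\<lambda>x. S - {x}) ` S)" using assms by blast
    fix T assume "T \<in> (\<lambda>x. S - {x}) ` S"
    then obtain x where x: "x \<in> S" "T = S - {x}" by blast
    have "openin (top_of_set S) T"
      unfolding x openin_open by (intro exI[of _ "- {x}"]) auto
    moreover have "x \<in> closure T"
      unfolding closure_approachable x
    proof (intro allI impI)
      fix e :: real assume "e > 0"
      then show "\<exists>y\<in>S - {x}. dist y x < e" using neg x(1) by (auto simp: dist_real_def)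
    qed
    then have "S \<subseteq> closure T" using closure_subset[of T] x by auto
    ultimately show "openin (top_of_set S) T \<and> S \<subseteq> closure T" by blast
  qed
  moreover have "\<Inter>((\<lambda>x. S - {x}) ` S) = {}" using assms(3) by blast
  ultimately show False using assms(3) by simp
qed

section \<open>Self-adjoint operators with countable spectrum\<close>

text \<open>Graphs let bounded and unbounded operators share one notion of regularity. Only a lower
  bound is asked for; that it yields solvability for self-adjoint graphs is
  \<open>resolvent_exists\<close>.\<close>

definition regular_at :: "('a::real_normed_vector \<times> 'a) set \<Rightarrow> real \<Rightarrow> bool" where
  "regular_at \<Gamma> t \<longleftrightarrow> (\<exists>c>0. \<forall>u u'. (u, u') \<in> \<Gamma> \<longrightarrow> c * norm u \<le> norm (u' - t *\<^sub>R u))"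

definition spec :: "('a::real_normed_vector \<times> 'a) set \<Rightarrow> real set" where
  "spec \<Gamma> = {t. \<not> regular_at \<Gamma> t}"

definition eigenvecs :: "('a::real_normed_vector \<times> 'a) set \<Rightarrow> 'a set" where
  "eigenvecs \<Gamma> = {u. \<exists>t. (u, t *\<^sub>R u) \<in> \<Gamma>}"

lemma regular_atI:
  "0 < c \<Longrightarrow> (\<And>u u'. (u, u') \<in> \<Gamma> \<Longrightarrow> c * norm u \<le> norm (u' - t *\<^sub>R u)) \<Longrightarrow> regular_at \<Gamma> t"
  unfolding regular_at_def by blast

lemma regular_atE:
  assumes "regular_at \<Gamma> t"
  obtains c where "0 < c" "\<And>u u'. (u, u') \<in> \<Gamma> \<Longrightarrow> c * norm u \<le> norm (u' - t *\<^sub>R u)"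
  using assms unfolding regular_at_def by metis

text \<open>A lower bound \<open>c\<close> at \<open>t\<close> loses at most
  \<open>\<bar>y - t\<bar>\<close> on passing to \<open>y\<close>, so half of it survives within
  distance \<open>c/2\<close>.\<close>

lemma closed_spec: "closed (spec \<Gamma>)"
proof -
  have "open {t. regular_at \<Gamma> t}"
    unfolding open_dist
  proof safe
    fix t assume "regular_at \<Gamma> t"
    then obtain c where c: "0 < c" "\<And>u u'. (u, u') \<in> \<Gamma> \<Longrightarrow> c * norm u \<le> norm (u' - t *\<^sub>R u)"
      using regular_atE by metis
    show "\<exists>e>0. \<forall>y. dist y t < e \<longrightarrow> y \<in> {t. regular_at \<Gamma> t}"
    proof (intro exI[of _ "c/2"] conjI allI impI CollectI)
      fix y assume y: "dist y t < c/2"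
      show "regular_at \<Gamma> y"
      proof (rule regular_atI[of "c/2"])
        fix u u' assume "(u, u') \<in> \<Gamma>"
        then have "c * norm u \<le> norm (u' - t *\<^sub>R u)" by (rule c)
        also have "u' - t *\<^sub>R u = (u' - y *\<^sub>R u) + (y - t) *\<^sub>R u" by (simp add: algebra_simps)
        also have "norm \<dots> \<le> norm (u' - y *\<^sub>R u) + \<bar>y - t\<bar> * norm u"
          using norm_triangle_ineq[of "u' - y *\<^sub>R u" "(y - t) *\<^sub>R u"] by simp
        also have "\<bar>y - t\<bar> * norm u \<le> (c/2) * norm u"
          using y by (intro mult_right_mono) (auto simp: dist_real_def)
        finally show "c/2 * norm u \<le> norm (u' - y *\<^sub>R u)" by (simp add: algebra_simps)
      qed (use c in auto)
    qed (use c in auto)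
  qed
  moreover have "- spec \<Gamma> = {t. regular_at \<Gamma> t}" by (auto simp: spec_def)
  ultimately show ?thesis by (simp add: closed_def)
qed

lemma spec_mono: "\<Gamma> \<subseteq> \<Gamma>' \<Longrightarrow> spec \<Gamma> \<subseteq> spec \<Gamma>'"
  unfolding spec_def regular_at_def by blast

text \<open>All axioms are relative to a closed subspace \<open>L\<close>, so that the theory can be
  applied again to the invariant complement of the eigenvectors without a new type.\<close>

locale bounded_symmetric =
  fixes L :: "'a::{real_inner,complete_space} set" and R :: "'a \<Rightarrow> 'a"
  assumes subspace: "subspace L" and closed: "closed L"
    and maps: "u \<in> L \<Longrightarrow> R u \<in> L"
    and add: "u \<in> L \<Longrightarrow> w \<in> L \<Longrightarrow> R (u + w) = R u + R w"
    and scale: "u \<in> L \<Longrightarrow> R (t *\<^sub>R u) = t *\<^sub>R R u"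
    and sym: "u \<in> L \<Longrightarrow> w \<in> L \<Longrightarrow> inner (R u) w = inner u (R w)"
    and bound: "\<exists>K. \<forall>u\<in>L. norm (R u) \<le> K * norm u"
begin

abbreviation graph :: "('a \<times> 'a) set" where "graph \<equiv> (\<lambda>u. (u, R u)) ` L"

lemma diff: "u \<in> L \<Longrightarrow> w \<in> L \<Longrightarrow> R (u - w) = R u - R w"
  using add[of u "- w"] scale[of w "-1"] subspace_neg[OF subspace, of w] by simp

lemma regular_graphE:
  assumes "regular_at graph t"
  obtains c where "0 < c" "\<And>u. u \<in> L \<Longrightarrow> c * norm u \<le> norm (R u - t *\<^sub>R u)"
  using assms unfolding regular_at_def by auto

text \<open>For the optimal constant \<open>m\<close>, the form of \<open>(R - s)\<^sup>2 - m\<^sup>2 = (R - s - m) (R - s + m)\<close> is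
  nonnegative, so Cauchy-Schwarz for this form turns lower bounds of the two factors into a
  better constant.\<close>
lemma lower_bound_from_gap:
  assumes gap: "\<And>t. \<bar>t - s\<bar> < c \<Longrightarrow> regular_at graph t" and u: "u \<in> L"
  shows "c * norm u \<le> norm (R u - s *\<^sub>R u)"
proof (rule ccontr)
  define T where "T u = R u - s *\<^sub>R u" for u
  assume "\<not> ?thesis"
  then have lt: "norm (T u) < c * norm u" by (simp add: T_def)
  then have u0: "u \<noteq> 0" using scale[OF u, of 0] by (auto simp: T_def)
  note L_rules = subspace_add[OF subspace] subspace_diff[OF subspace] subspace_scale[OF subspace] maps
  have TL: "T w \<in> L" if "w \<in> L" for w using that by (simp add: T_def L_rules)
  have Tadd: "T (w + w') = T w + T w'" if "w \<in> L" "w' \<in> L" for w w'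
    using that by (simp add: T_def add algebra_simps)
  have Tscale: "T (t *\<^sub>R w) = t *\<^sub>R T w" if "w \<in> L" for w t
    using that by (simp add: T_def scale algebra_simps)
  have Tdiff: "T (w - w') = T w - T w'" if "w \<in> L" "w' \<in> L" for w w'
    using that by (simp add: T_def diff algebra_simps)
  have Tsym: "inner (T w) w' = inner w (T w')" if "w \<in> L" "w' \<in> L" for w w'
    using that by (simp add: T_def sym inner_diff)
  obtain K where K: "\<And>w. w \<in> L \<Longrightarrow> norm (R w) \<le> K * norm w" using bound by blast
  define B where "B = \<bar>K\<bar> + \<bar>s\<bar>"
  have B0: "B \<ge> 0" by (simp add: B_def)
  have TB: "norm (T w) \<le> B * norm w" if "w \<in> L" for w
  proof -
    have "norm (T w) \<le> norm (R w) + \<bar>s\<bar> * norm w"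
      unfolding T_def using norm_triangle_ineq4[of "R w" "s *\<^sub>R w"] by simp
    also have "norm (R w) \<le> \<bar>K\<bar> * norm w"
      using K[OF that] mult_right_mono[OF abs_ge_self[of K] norm_ge_zero[of w]] by linarith
    finally show ?thesis by (simp add: B_def algebra_simps)
  qed
  define A where "A = {norm (T w) / norm w | w. w \<in> L \<and> w \<noteq> 0}"
  \<comment> \<open>The optimal constant. The vector \<open>u\<close> forces it below
    \<open>c\<close>, which puts both \<open>s + m\<close> and \<open>s - m\<close> into the gap,
    where the lower bounds \<open>c1\<close> and \<open>c2\<close> exist.\<close>
  define m where "m = Inf A"
  have Ane: "A \<noteq> {}" using u u0 by (auto simp: A_def)
  have Abdd: "bdd_below A" by (rule bdd_belowI[of _ 0]) (auto simp: A_def)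
  have m0: "m \<ge> 0" unfolding m_def by (rule cInf_greatest[OF Ane]) (auto simp: A_def)
  have "m \<le> norm (T u) / norm u"
    unfolding m_def by (rule cInf_lower[OF _ Abdd]) (use u u0 in \<open>auto simp: A_def\<close>)
  also have "\<dots> < c" using lt u0 by (simp add: divide_less_eq)
  finally have mc: "m < c" .
  have mT: "m * norm w \<le> norm (T w)" if "w \<in> L" for w
  proof (cases "w = 0")
    case False
    then have "m \<le> norm (T w) / norm w"
      unfolding m_def using that by (intro cInf_lower[OF _ Abdd]) (auto simp: A_def)
    then show ?thesis using False by (simp add: field_simps)
  qed auto
  obtain c1 where c1: "0 < c1" "\<And>w. w \<in> L \<Longrightarrow> c1 * norm w \<le> norm (R w - (s + m) *\<^sub>R w)"
    using gap[of "s + m"] m0 mc by (auto elim!: regular_graphE)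
  obtain c2 where c2: "0 < c2" "\<And>w. w \<in> L \<Longrightarrow> c2 * norm w \<le> norm (R w - (s - m) *\<^sub>R w)"
    using gap[of "s - m"] m0 mc by (auto elim!: regular_graphE)
  define Q where "Q w = T (T w) - m\<^sup>2 *\<^sub>R w" for w
  have QL: "Q w \<in> L" if "w \<in> L" for w using that by (simp add: Q_def TL L_rules)
  have Qlow: "c1 * c2 * norm w \<le> norm (Q w)" if "w \<in> L" for w
  proof -
    define y where "y = R w - (s - m) *\<^sub>R w"
    have yL: "y \<in> L" using that by (simp add: y_def L_rules)
    have y: "y = T w + m *\<^sub>R w" by (simp add: y_def T_def algebra_simps)
    have "c1 * c2 * norm w \<le> c1 * norm y" using c1(1) c2(2)[OF that] by (simp add: y_def)
    also have "\<dots> \<le> norm (T y - m *\<^sub>R y)" using c1(2)[OF yL] by (simp add: T_def algebra_simps)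
    also have "T y - m *\<^sub>R y = Q w"
      using that by (simp add: y Q_def Tadd Tscale TL L_rules algebra_simps power2_eq_square)
    finally show ?thesis .
  qed
  have Qform: "inner (Q w) w = (norm (T w))\<^sup>2 - m\<^sup>2 * (norm w)\<^sup>2" if "w \<in> L" for w
    using that by (simp add: Q_def inner_diff Tsym TL power2_norm_eq_inner)
  have Qpos: "inner (Q w) w \<ge> 0" if "w \<in> L" for w
    using power_mono[OF mT[OF that], of 2] m0 by (simp add: Qform[OF that] power_mult_distrib)
  have Qsym: "inner (Q w) w' = inner w (Q w')" if "w \<in> L" "w' \<in> L" for w w'
    using that by (simp add: Q_def inner_diff Tsym TL)
  have Qdiff: "Q (w - t *\<^sub>R w') = Q w - t *\<^sub>R Q w'" if "w \<in> L" "w' \<in> L" for w w' t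
    using that by (simp add: Q_def Tdiff Tscale TL L_rules algebra_simps)
  \<comment> \<open>A bound for the quadratic form of \<open>Q\<close>; the summand 1 keeps it
    positive even if \<open>B = 0\<close>.\<close>
  define k where "k = B\<^sup>2 + 1"
  have k: "k > 0" by (simp add: k_def add_nonneg_pos)
  have Qk: "inner (Q w) w \<le> k * (norm w)\<^sup>2" if "w \<in> L" for w
  proof -
    have "(norm (T w))\<^sup>2 \<le> (B * norm w)\<^sup>2" using TB[OF that] by (intro power_mono) auto
    moreover have "m\<^sup>2 * (norm w)\<^sup>2 \<ge> 0" "(norm w)\<^sup>2 \<ge> 0" by auto
    ultimately show ?thesis
      unfolding Qform[OF that] k_def distrib_right power_mult_distrib by linarith
  qed
  have QCS: "(norm (Q w))\<^sup>2 \<le> k * inner (Q w) w" if "w \<in> L" for w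
  proof -
    \<comment> \<open>Nonnegativity of the form is tested at \<open>w - t *\<^sub>R Q w\<close>;
      since \<open>k\<close> bounds the form at \<open>Q w\<close>, this step length leaves the
      Cauchy-Schwarz type estimate.\<close>
    define t where "t = 1 / k"
    have t: "t > 0" using k by (simp add: t_def)
    have "0 \<le> inner (Q (w - t *\<^sub>R Q w)) (w - t *\<^sub>R Q w)"
      using that by (intro Qpos) (simp add: QL L_rules)
    also have "\<dots> = inner (Q w) w - 2 * t * (norm (Q w))\<^sup>2 + t\<^sup>2 * inner (Q (Q w)) (Q w)"
      using that Qsym[OF QL[OF that] that] by (simp add: Qdiff QL inner_diff dot_square_norm power2_eq_square algebra_simps inner_commute)
    also have "\<dots> \<le> inner (Q w) w - 2 * t * (norm (Q w))\<^sup>2 + t\<^sup>2 * (k * (norm (Q w))\<^sup>2)"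
      using Qk[OF QL[OF that]] by (intro add_left_mono mult_left_mono) auto
    also have "\<dots> = inner (Q w) w - t * (norm (Q w))\<^sup>2"
      using k by (simp add: t_def power2_eq_square)
    finally show ?thesis using k by (simp add: t_def field_simps)
  qed
  \<comment> \<open>The strict gain: \<open>sqrt (m\<^sup>2 + \<delta>)\<close> becomes an
    admissible constant, against \<open>m\<close> being the infimum.\<close>
  define \<delta> where "\<delta> = (c1 * c2)\<^sup>2 / k"
  have \<delta>: "\<delta> > 0" using c1 c2 k by (simp add: \<delta>_def)
  have better: "(m\<^sup>2 + \<delta>) * (norm w)\<^sup>2 \<le> (norm (T w))\<^sup>2" if "w \<in> L" for w
  proof -
    have "(c1 * c2 * norm w)\<^sup>2 \<le> (norm (Q w))\<^sup>2"
      using Qlow[OF that] c1 c2 by (intro power_mono) auto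
    also have "\<dots> \<le> k * inner (Q w) w" by (rule QCS[OF that])
    finally have "\<delta> * (norm w)\<^sup>2 \<le> inner (Q w) w"
      using k by (simp add: \<delta>_def field_simps power_mult_distrib)
    then show ?thesis by (simp add: Qform[OF that] algebra_simps)
  qed
  have "sqrt (m\<^sup>2 + \<delta>) \<le> m"
    unfolding m_def
  proof (rule cInf_greatest[OF Ane], fold m_def)
    fix a assume "a \<in> A"
    then obtain w where w: "w \<in> L" "w \<noteq> 0" "a = norm (T w) / norm w" by (auto simp: A_def)
    have "m\<^sup>2 + \<delta> \<le> a\<^sup>2"
      using better[OF w(1)] w(2) by (simp add: w(3) power_divide pos_le_divide_eq)
    moreover have "a \<ge> 0" using w by simp
    ultimately show "sqrt (m\<^sup>2 + \<delta>) \<le> a" by (simp add: real_le_lsqrt)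
  qed
  then have "m\<^sup>2 + \<delta> \<le> m\<^sup>2" by (rule sqrt_le_D)
  with \<delta> show False by simp
qed

text \<open>With a gap of width \<open>r = 2 s\<close> on both sides of \<open>t\<close>, the operator \<open>T = R - t\<close> satisfies
  \<open>norm ((T\<^sup>2 - s\<^sup>2) u) \<ge> s\<^sup>2 * norm u\<close>; expanding the square bounds \<open>T\<close> from below on its range,
  which is dense when \<open>T\<close> is injective.\<close>
lemma isolated_point_is_eigenvalue:
  assumes r: "r > 0" and gap: "\<And>y. y \<noteq> t \<Longrightarrow> \<bar>y - t\<bar> < r \<Longrightarrow> regular_at graph y"
    and inj: "\<And>u. u \<in> L \<Longrightarrow> R u = t *\<^sub>R u \<Longrightarrow> u = 0"
  shows "regular_at graph t"
proof -
  \<comment> \<open>The open intervals of radius \<open>s\<close> about \<open>t + s\<close> and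
    \<open>t - s\<close> avoid \<open>t\<close> and stay within distance \<open>r\<close> of it, so
    both centres have lower bounds with constant \<open>s\<close>.\<close>
  define s where "s = r / 2"
  have s: "s > 0" using r by (simp add: s_def)
  define T where "T u = R u - t *\<^sub>R u" for u
  note L_rules = subspace_add[OF subspace] subspace_diff[OF subspace] subspace_scale[OF subspace] maps
  have TL: "T w \<in> L" if "w \<in> L" for w using that by (simp add: T_def L_rules)
  have Tadd: "T (w + w') = T w + T w'" if "w \<in> L" "w' \<in> L" for w w'
    using that by (simp add: T_def add algebra_simps)
  have Tscale: "T (a *\<^sub>R w) = a *\<^sub>R T w" if "w \<in> L" for w a
    using that by (simp add: T_def scale algebra_simps)
  have Tdiff: "T (w - w') = T w - T w'" if "w \<in> L" "w' \<in> L" for w w'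
    using that by (simp add: T_def diff algebra_simps)
  have Tsym: "inner (T w) w' = inner w (T w')" if "w \<in> L" "w' \<in> L" for w w'
    using that by (simp add: T_def sym inner_diff)
  have up: "s * norm w \<le> norm (R w - (t + s) *\<^sub>R w)" if "w \<in> L" for w
  proof (rule lower_bound_from_gap[OF gap that])
    fix y assume "\<bar>y - (t + s)\<bar> < s"
    then show "y \<noteq> t" "\<bar>y - t\<bar> < r" using s unfolding s_def by linarith+
  qed
  have down: "s * norm w \<le> norm (R w - (t - s) *\<^sub>R w)" if "w \<in> L" for w
  proof (rule lower_bound_from_gap[OF gap that])
    fix y assume "\<bar>y - (t - s)\<bar> < s"
    then show "y \<noteq> t" "\<bar>y - t\<bar> < r" using s unfolding s_def by linarith+
  qed
  have TT: "s\<^sup>2 * norm w \<le> norm (T (T w) - s\<^sup>2 *\<^sub>R w)" if "w \<in> L" for w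
  proof -
    define y where "y = R w - (t - s) *\<^sub>R w"
    have yL: "y \<in> L" using that by (simp add: y_def L_rules)
    have y: "y = T w + s *\<^sub>R w" by (simp add: y_def T_def algebra_simps)
    have "s\<^sup>2 * norm w \<le> s * norm y" using s down[OF that] by (simp add: y_def power2_eq_square)
    also have "\<dots> \<le> norm (T y - s *\<^sub>R y)" using up[OF yL] by (simp add: T_def algebra_simps)
    also have "T y - s *\<^sub>R y = T (T w) - s\<^sup>2 *\<^sub>R w"
      using that by (simp add: y Tadd Tscale TL L_rules algebra_simps power2_eq_square)
    finally show ?thesis .
  qed
  have range_low: "s * norm (T w) \<le> norm (T (T w))" if "w \<in> L" for w
  proof -
    have "(s\<^sup>2 * norm w)\<^sup>2 \<le> (norm (T (T w) - s\<^sup>2 *\<^sub>R w))\<^sup>2"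
      using TT[OF that] by (intro power_mono) auto
    also have "\<dots> = (norm (T (T w)))\<^sup>2 - 2 * s\<^sup>2 * (norm (T w))\<^sup>2 + (s\<^sup>2 * norm w)\<^sup>2"
      using that Tsym[OF TL[OF that] that] Tsym[OF that TL[OF that]]
      by (simp add: power2_norm_eq_inner inner_diff power_mult_distrib) (simp add: power2_eq_square power4_eq_xxxx algebra_simps inner_commute)
    \<comment> \<open>The terms \<open>(s\<^sup>2 * norm w)\<^sup>2\<close> cancel, which leaves an
      estimate in \<open>T w\<close> alone and hence a lower bound on the range of
      \<open>T\<close>.\<close>
    finally have "2 * s\<^sup>2 * (norm (T w))\<^sup>2 \<le> (norm (T (T w)))\<^sup>2" by simp
    moreover have "s\<^sup>2 * (norm (T w))\<^sup>2 \<ge> 0" by simp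
    ultimately have "(s * norm (T w))\<^sup>2 \<le> (norm (T (T w)))\<^sup>2"
      unfolding power_mult_distrib by linarith
    then show ?thesis by (rule power2_le_imp_le) simp
  qed
  have sub: "subspace (T ` L)"
  proof (rule subspaceI)
    show "0 \<in> T ` L" using Tscale[OF subspace_0[OF subspace], of 0] subspace_0[OF subspace] by (metis image_eqI scaleR_zero_left)
    show "x + y \<in> T ` L" if "x \<in> T ` L" "y \<in> T ` L" for x y
      using that Tadd subspace_add[OF subspace] by (auto simp: image_iff) metis
    show "a *\<^sub>R x \<in> T ` L" if "x \<in> T ` L" for a x
      using that Tscale subspace_scale[OF subspace] by (auto simp: image_iff) metis
  qed
  have dense: "w \<in> closure (T ` L)" if "w \<in> L" for w
  proof (rule in_closure_if_orthogonal[OF sub _ subspace closed that])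
    show "T ` L \<subseteq> L" using TL by blast
    fix z assume z: "z \<in> L" "\<And>m. m \<in> T ` L \<Longrightarrow> inner z m = 0"
    have "inner (T z) (T z) = inner z (T (T z))" using z TL by (simp add: Tsym)
    also have "\<dots> = 0" using z TL by blast
    finally have "T z = 0" by simp
    then show "z = 0" using inj[OF z(1)] by (simp add: T_def)
  qed
  obtain K where K: "\<And>w. w \<in> L \<Longrightarrow> norm (R w) \<le> K * norm w" using bound by blast
  show ?thesis
  proof (rule regular_atI[OF s])
    fix u u' assume "(u, u') \<in> graph"
    then have u: "u \<in> L" "u' = R u" by auto
    obtain f where f: "\<And>n. f n \<in> T ` L" "f \<longlonglongrightarrow> u"
      using dense[OF u(1)] unfolding closure_sequential by metis
    have fL: "f n \<in> L" for n using f(1)[of n] by (auto intro: TL)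
    have "(\<lambda>n. R (f n)) \<longlonglongrightarrow> R u"
    proof (rule LIM_zero_cancel, rule tendsto_norm_zero_cancel, rule tendsto_sandwich)
      show "\<forall>\<^sub>F n in sequentially. 0 \<le> norm (R (f n) - R u)" by simp
      show "\<forall>\<^sub>F n in sequentially. norm (R (f n) - R u) \<le> K * norm (f n - u)"
        using K[OF subspace_diff[OF subspace fL u(1)]] diff[OF fL u(1)] by simp
      have "(\<lambda>n. K * norm (f n - u)) \<longlonglongrightarrow> K * norm (u - u)" by (intro tendsto_intros f)
      then show "(\<lambda>n. K * norm (f n - u)) \<longlonglongrightarrow> 0" by simp
    qed simp
    then have lim: "(\<lambda>n. T (f n)) \<longlonglongrightarrow> T u" unfolding T_def by (intro tendsto_intros f)
    have "s * norm u \<le> norm (T u)"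
    proof (rule LIMSEQ_le)
      show "(\<lambda>n. s * norm (f n)) \<longlonglongrightarrow> s * norm u" by (intro tendsto_intros f)
      show "(\<lambda>n. norm (T (f n))) \<longlonglongrightarrow> norm (T u)" by (intro tendsto_intros lim)
      have "s * norm (f n) \<le> norm (T (f n))" for n using f(1)[of n] by (auto simp: range_low)
      then show "\<exists>N. \<forall>n\<ge>N. s * norm (f n) \<le> norm (T (f n))" by blast
    qed
    then show "s * norm u \<le> norm (u' - t *\<^sub>R u)" by (simp add: u T_def)
  qed
qed

theorem eigenvectors_total:
  assumes count: "countable (spec graph)"
  shows "L \<subseteq> closure (span (eigenvecs graph))"
proof -
  define E where "E = eigenvecs graph"
  have E: "E = {u \<in> L. \<exists>t. R u = t *\<^sub>R u}" unfolding E_def eigenvecs_def by (auto simp: image_iff) metis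
  have spanL: "span E \<subseteq> L" using subspace E by (intro span_minimal) auto
  define G where "G = {u \<in> L. \<forall>e\<in>E. inner u e = 0}"
  have "bounded_symmetric G R"
  proof
    show "subspace G"
      using subspace unfolding G_def subspace_def by (auto simp: inner_add_left)
    have "G = L \<inter> (\<Inter>e\<in>E. {u. inner u e = 0})" by (auto simp: G_def)
    moreover have "closed {u. inner u e = 0}" for e :: 'a
      by (intro closed_Collect_eq continuous_intros)
    ultimately show "closed G" using closed by auto
    show "R u \<in> G" if "u \<in> G" for u
    proof -
      have "inner (R u) e = 0" if "e \<in> E" for e
      proof -
        obtain t where "R e = t *\<^sub>R e" "e \<in> L" using \<open>e \<in> E\<close> E by auto
        then show ?thesis using \<open>u \<in> G\<close> \<open>e \<in> E\<close> by (auto simp: G_def sym)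
      qed
      then show ?thesis using that maps by (auto simp: G_def)
    qed
    show "\<exists>K. \<forall>u\<in>G. norm (R u) \<le> K * norm u" using bound by (auto simp: G_def)
  qed (auto simp: G_def add scale sym)
  then interpret G: bounded_symmetric G R .
  have "spec G.graph \<subseteq> spec graph" by (rule spec_mono) (auto simp: G_def)
  with count have cG: "countable (spec G.graph)" by (rule countable_subset[rotated])
  have noeig: "u = 0" if "u \<in> G" "R u = t *\<^sub>R u" for u t
    using that by (auto simp: G_def E)
  have "spec G.graph = {}"
  proof (rule ccontr)
    assume "spec G.graph \<noteq> {}"
    then obtain x r where x: "x \<in> spec G.graph" "r > 0" "\<And>y. y \<in> spec G.graph \<Longrightarrow> \<bar>y - x\<bar> < r \<Longrightarrow> y = x"
      using countable_closed_has_isolated_point[OF closed_spec cG] by metis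
    have "regular_at G.graph x"
      by (rule G.isolated_point_is_eigenvalue[OF x(2)]) (use x noeig in \<open>auto simp: spec_def\<close>)
    with x(1) show False by (simp add: spec_def)
  qed
  then have reg: "regular_at G.graph t" for t by (auto simp: spec_def)
  have G0: "u = 0" if "u \<in> G" for u
  proof (rule ccontr)
    assume "u \<noteq> 0"
    \<comment> \<open>With empty spectrum every radius is a gap, so
      \<open>lower_bound_from_gap\<close> holds with any constant, including this one, which
      \<open>u\<close> violates.\<close>
    have "((norm (R u) + 1) / norm u) * norm u \<le> norm (R u - 0 *\<^sub>R u)"
      by (rule G.lower_bound_from_gap[OF _ that]) (rule reg)
    with \<open>u \<noteq> 0\<close> show False by simp
  qed
  show ?thesis
  proof
    fix x assume "x \<in> L"
    then show "x \<in> closure (span (eigenvecs graph))"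
      unfolding E_def[symmetric]
      by (rule in_closure_if_orthogonal[OF subspace_span spanL subspace closed])
        (auto intro!: G0 simp: G_def span_base)
  qed
qed

end

text \<open>On the span of \<open>E\<close> the inverse of \<open>H - t\<close> is explicit and
  bounded by \<open>1/d\<close>. It is applied to an approximant \<open>x\<close> of
  \<open>w\<close> and moved by symmetry onto \<open>z\<close>, the residual of \<open>w\<close>.
  Applying the operator itself to approximants would fail: they tend to \<open>w\<close> in norm,
  but their images need not tend to \<open>w'\<close>.\<close>

lemma regular_if_eigenvectors_total:
  fixes \<Gamma> :: "('a::real_inner \<times> 'a) set"
  assumes symm: "\<And>u u' w w'. (u, u') \<in> \<Gamma> \<Longrightarrow> (w, w') \<in> \<Gamma> \<Longrightarrow> inner u' w = inner u w'"
    and E: "\<And>e. e \<in> E \<Longrightarrow> \<exists>\<mu>. (e, \<mu> *\<^sub>R e) \<in> \<Gamma> \<and> d \<le> \<bar>\<mu> - t\<bar>"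
    and total: "fst ` \<Gamma> \<subseteq> closure (span E)" and d: "d > 0"
  shows "regular_at \<Gamma> t"
proof (rule regular_atI[OF d])
  fix w w' assume w: "(w, w') \<in> \<Gamma>"
  define z where "z = w' - t *\<^sub>R w"
  obtain \<mu> where \<mu>: "\<And>e. e \<in> E \<Longrightarrow> (e, \<mu> e *\<^sub>R e) \<in> \<Gamma>" "\<And>e. e \<in> E \<Longrightarrow> d \<le> \<bar>\<mu> e - t\<bar>"
    using E by metis
  have bound: "d * inner x w \<le> norm x * norm z" if xE: "x \<in> span E" for x
  proof -
    obtain F c where F: "finite F" "F \<subseteq> E" and x: "x = (\<Sum>e\<in>F. c e *\<^sub>R e)"
      using xE by (auto simp: span_explicit)
    \<comment> \<open>Terms are grouped by eigenvalue: symmetry makes different groups orthogonal,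
      whereas members of \<open>E\<close> with the same eigenvalue need not be.\<close>
    define v where "v a = (\<Sum>e\<in>{e\<in>F. \<mu> e = a}. c e *\<^sub>R e)" for a
    define y where "y = (\<Sum>a\<in>\<mu> ` F. (1 / (a - t)) *\<^sub>R v a)"
    have xv: "x = (\<Sum>a\<in>\<mu> ` F. v a)"
      unfolding x v_def using F(1) by (rule sum.image_gen)
    have orth: "inner (v a) (v b) = 0" if "a \<noteq> b" for a b
    proof -
      have "inner e e' = 0" if "e \<in> E" "e' \<in> E" "\<mu> e = a" "\<mu> e' = b" for e e'
        using symm[OF \<mu>(1)[OF that(1)] \<mu>(1)[OF that(2)]] that \<open>a \<noteq> b\<close> by simp
      then show ?thesis
        using subsetD[OF F(2)]
        unfolding v_def inner_sum_left inner_sum_right by (intro sum.neutral ballI) simp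
    qed
    have nx: "(norm x)\<^sup>2 = (\<Sum>a\<in>\<mu> ` F. (norm (v a))\<^sup>2)"
      unfolding xv using F(1) orth
      by (intro norm_sum_Pythagorean) (auto simp: pairwise_def orthogonal_def)
    have ny: "(norm y)\<^sup>2 = (\<Sum>a\<in>\<mu> ` F. (norm ((1 / (a - t)) *\<^sub>R v a))\<^sup>2)"
      unfolding y_def using F(1) orth
      by (intro norm_sum_Pythagorean) (auto simp: pairwise_def orthogonal_def)
    have "(d * norm y)\<^sup>2 = (\<Sum>a\<in>\<mu> ` F. d\<^sup>2 * (norm ((1 / (a - t)) *\<^sub>R v a))\<^sup>2)"
      by (simp add: power_mult_distrib ny sum_distrib_left)
    also have "\<dots> \<le> (norm x)\<^sup>2"
      unfolding nx
    proof (rule sum_mono)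
      fix a assume "a \<in> \<mu> ` F"
      then have "d \<le> \<bar>a - t\<bar>" using \<mu>(2) F(2) by auto
      then have "d\<^sup>2 \<le> (a - t)\<^sup>2" and ne: "(a - t)\<^sup>2 > 0" using d by (auto simp: abs_le_square_iff[symmetric])
      then have "d\<^sup>2 / (a - t)\<^sup>2 \<le> 1" by (simp add: divide_le_eq_1)
      from mult_right_mono[OF this, of "(norm (v a))\<^sup>2"]
      show "d\<^sup>2 * (norm ((1 / (a - t)) *\<^sub>R v a))\<^sup>2 \<le> (norm (v a))\<^sup>2"
        by (simp add: power_mult_distrib power_divide)
    qed
    finally have dy: "d * norm y \<le> norm x" by (rule power2_le_imp_le) simp
    have "inner (v a) z = (a - t) * inner (v a) w" for a
    proof -
      have "inner e z = (a - t) * inner e w" if "e \<in> E" "\<mu> e = a" for e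
        using symm[OF \<mu>(1)[OF that(1)] w] that by (simp add: z_def inner_diff algebra_simps)
      then show ?thesis
        using subsetD[OF F(2)] unfolding v_def inner_sum_left sum_distrib_left
        by (intro sum.cong refl) simp
    qed
    moreover have "a \<noteq> t" if "a \<in> \<mu> ` F" for a using that \<mu>(2) F(2) d by fastforce
    ultimately have "inner y z = inner x w"
      by (auto simp: y_def xv inner_sum_left intro!: sum.cong)
    then have "d * inner x w \<le> d * (norm y * norm z)"
      using norm_cauchy_schwarz[of y z] d by simp
    also have "\<dots> \<le> norm x * norm z" using mult_right_mono[OF dy norm_ge_zero[of z]] by (simp add: mult.assoc)
    finally show ?thesis .
  qed
  have "w \<in> closure (span E)" using total w by force
  then obtain f where f: "\<And>n. f n \<in> span E" "f \<longlonglongrightarrow> w" by (auto simp: closure_sequential)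
  have "d * inner w w \<le> norm w * norm z"
  proof (rule LIMSEQ_le)
    show "(\<lambda>n. d * inner (f n) w) \<longlonglongrightarrow> d * inner w w" by (intro tendsto_intros f)
    show "(\<lambda>n. norm (f n) * norm z) \<longlonglongrightarrow> norm w * norm z" by (intro tendsto_intros f)
  qed (use bound f in auto)
  then have "(d * norm w) * norm w \<le> norm z * norm w"
    by (simp add: power2_norm_eq_inner[symmetric] power2_eq_square algebra_simps)
  then show "d * norm w \<le> norm (w' - t *\<^sub>R w)"
    by (cases "w = 0") (auto simp: z_def)
qed

section \<open>Eigenvalues of symmetric operators in a separable space\<close>

lemma bessel_inequality:
  fixes e :: "'i \<Rightarrow> 'a::real_inner"
  assumes "finite A" "\<And>i. i \<in> A \<Longrightarrow> norm (e i) = 1"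
    "\<And>i j. i \<in> A \<Longrightarrow> j \<in> A \<Longrightarrow> i \<noteq> j \<Longrightarrow> inner (e i) (e j) = 0"
  shows "(\<Sum>i\<in>A. (inner (e i) x)\<^sup>2) \<le> (norm x)\<^sup>2"
proof -
  define p where "p = (\<Sum>i\<in>A. inner (e i) x *\<^sub>R e i)"
  have px: "inner p x = (\<Sum>i\<in>A. (inner (e i) x)\<^sup>2)"
    by (simp add: p_def inner_sum_left power2_eq_square)
  have "(norm p)\<^sup>2 = (\<Sum>i\<in>A. (norm (inner (e i) x *\<^sub>R e i))\<^sup>2)"
    unfolding p_def using assms
    by (intro norm_sum_Pythagorean) (auto simp: pairwise_def orthogonal_def)
  also have "\<dots> = (\<Sum>i\<in>A. (inner (e i) x)\<^sup>2)" using assms(2) by simp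
  finally have "inner p p = inner p x" by (simp add: px power2_norm_eq_inner)
  then have "0 \<le> inner x x - inner p x"
    using inner_ge_zero[of "x - p"] by (simp add: inner_diff inner_commute)
  then show ?thesis by (simp add: px power2_norm_eq_inner)
qed

text \<open>By Bessel, for each \<open>x\<close> in \<open>D\<close> and each \<open>n\<close> only
  finitely many of the orthonormal eigenvectors have squared inner product at least
  \<open>1 / (n + 1)\<close> with \<open>x\<close>, and none of them is orthogonal to all of
  \<open>D\<close>.\<close>

lemma countable_eigenvalues:
  fixes \<Gamma> :: "('a::real_inner \<times> 'a) set"
  assumes symm: "\<And>u u' w w'. (u, u') \<in> \<Gamma> \<Longrightarrow> (w, w') \<in> \<Gamma> \<Longrightarrow> inner u' w = inner u w'"
    and scale: "\<And>u u' c. (u, u') \<in> \<Gamma> \<Longrightarrow> (c *\<^sub>R u, c *\<^sub>R u') \<in> \<Gamma>"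
    and D: "countable D" "\<And>u u'. (u, u') \<in> \<Gamma> \<Longrightarrow> (\<And>x. x \<in> D \<Longrightarrow> inner u x = 0) \<Longrightarrow> u = 0"
  shows "countable {t. \<exists>u. u \<noteq> 0 \<and> (u, t *\<^sub>R u) \<in> \<Gamma>}"
proof -
  define A where "A = {t. \<exists>u. u \<noteq> 0 \<and> (u, t *\<^sub>R u) \<in> \<Gamma>}"
  have "\<exists>u. norm u = 1 \<and> (u, t *\<^sub>R u) \<in> \<Gamma>" if t: "t \<in> A" for t
  proof -
    obtain u where "u \<noteq> 0" "(u, t *\<^sub>R u) \<in> \<Gamma>" using t by (auto simp: A_def)
    then show ?thesis
      using scale[of u "t *\<^sub>R u" "1 / norm u"] by (intro exI[of _ "(1 / norm u) *\<^sub>R u"]) (simp add: algebra_simps)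
  qed
  then obtain e where e: "\<And>t. t \<in> A \<Longrightarrow> norm (e t) = 1" "\<And>t. t \<in> A \<Longrightarrow> (e t, t *\<^sub>R e t) \<in> \<Gamma>"
    by metis
  have orth: "inner (e s) (e t) = 0" if "s \<in> A" "t \<in> A" "s \<noteq> t" for s t
    using symm[OF e(2) e(2), of s t] that by simp
  have fin: "finite {t\<in>A. 1 / real (Suc n) \<le> (inner (e t) x)\<^sup>2}" for n x
  proof -
    obtain C :: nat where C: "real (Suc n) * (norm x)\<^sup>2 \<le> real C" using real_arch_simple by blast
    have "card B \<le> C" if B: "B \<subseteq> {t\<in>A. 1 / real (Suc n) \<le> (inner (e t) x)\<^sup>2}" "finite B" for B
    proof -
      have "real (card B) * (1 / real (Suc n)) = (\<Sum>t\<in>B. 1 / real (Suc n))" by simp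
      also have "\<dots> \<le> (\<Sum>t\<in>B. (inner (e t) x)\<^sup>2)" using B(1) by (intro sum_mono) auto
      also have "\<dots> \<le> (norm x)\<^sup>2" 
      proof (intro bessel_inequality B(2))
        show "norm (e t) = 1" if "t \<in> B" for t using that B(1) e by auto
        show "inner (e s) (e t) = 0" if "s \<in> B" "t \<in> B" "s \<noteq> t" for s t
          using that B(1) by (intro orth) auto
      qed
      finally have "real (card B) \<le> real (Suc n) * (norm x)\<^sup>2" by (simp add: field_simps)
      with C show ?thesis by linarith
    qed
    then show ?thesis using finite_if_finite_subsets_card_bdd by blast
  qed
  have "A \<subseteq> (\<Union>x\<in>D. \<Union>n. {t\<in>A. 1 / real (Suc n) \<le> (inner (e t) x)\<^sup>2})"
  proof
    fix t assume t: "t \<in> A"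
    have "e t \<noteq> 0" using e(1)[OF t] by auto
    then obtain x where x: "x \<in> D" "inner (e t) x \<noteq> 0" using D(2)[OF e(2)[OF t]] by blast
    then have "(inner (e t) x)\<^sup>2 > 0" by simp
    then obtain n where "1 / real (Suc n) < (inner (e t) x)\<^sup>2" using nat_approx_posE by blast
    with t x(1) show "t \<in> (\<Union>x\<in>D. \<Union>n. {t\<in>A. 1 / real (Suc n) \<le> (inner (e t) x)\<^sup>2})"
      by (auto intro: less_imp_le)
  qed
  moreover have "countable (\<Union>x\<in>D. \<Union>n. {t\<in>A. 1 / real (Suc n) \<le> (inner (e t) x)\<^sup>2})"
    using D(1) fin by (intro countable_UN) (auto intro: countable_finite)
  ultimately show ?thesis unfolding A_def[symmetric] by (rule countable_subset)
qed

text \<open>\<open>self_adjoint\<close> says that the graph equals its own adjoint within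
  \<open>L \<times> L\<close>. Linearity and closedness follow from it, because the condition on the
  right is linear in the pair and stable under limits. Such a relation may still be multivalued,
  which \<open>single_valued\<close> rules out.\<close>

locale self_adjoint_graph =
  fixes L :: "'a::{real_inner,complete_space} set" and \<Gamma> :: "('a \<times> 'a) set"
  assumes subspace: "subspace L" and closed: "closed L" and in_L: "\<Gamma> \<subseteq> L \<times> L"
    and self_adjoint: "w \<in> L \<Longrightarrow> w' \<in> L \<Longrightarrow>
      (w, w') \<in> \<Gamma> \<longleftrightarrow> (\<forall>u u'. (u, u') \<in> \<Gamma> \<longrightarrow> inner u' w = inner u w')"
    and single_valued: "(0, w) \<in> \<Gamma> \<Longrightarrow> w = 0"
begin

lemma in_L1: "(u, u') \<in> \<Gamma> \<Longrightarrow> u \<in> L" and in_L2: "(u, u') \<in> \<Gamma> \<Longrightarrow> u' \<in> L"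
  using in_L by auto

lemma symm: "(u, u') \<in> \<Gamma> \<Longrightarrow> (w, w') \<in> \<Gamma> \<Longrightarrow> inner u' w = inner u w'"
  using self_adjoint[of w w'] in_L1 in_L2 by blast

lemma graph_add: "(u, u') \<in> \<Gamma> \<Longrightarrow> (w, w') \<in> \<Gamma> \<Longrightarrow> (u + w, u' + w') \<in> \<Gamma>"
  by (subst self_adjoint) (auto simp: inner_add_right symm in_L1 in_L2 subspace_add[OF subspace])

lemma graph_scale: "(u, u') \<in> \<Gamma> \<Longrightarrow> (c *\<^sub>R u, c *\<^sub>R u') \<in> \<Gamma>"
  by (subst self_adjoint) (auto simp: symm in_L1 in_L2 subspace_scale[OF subspace])

lemma graph_diff: "(u, u') \<in> \<Gamma> \<Longrightarrow> (w, w') \<in> \<Gamma> \<Longrightarrow> (u - w, u' - w') \<in> \<Gamma>"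
  using graph_add[of u u' "-1 *\<^sub>R w" "-1 *\<^sub>R w'"] graph_scale[of w w' "-1"] by simp

lemma graph_zero: "(0, 0) \<in> \<Gamma>"
  by (subst self_adjoint) (auto simp: subspace_0[OF subspace])

lemma graph_limit:
  assumes "\<And>n. (f n, f' n) \<in> \<Gamma>" "f \<longlonglongrightarrow> u" "f' \<longlonglongrightarrow> u'"
  shows "(u, u') \<in> \<Gamma>"
proof (subst self_adjoint)
  show "u \<in> L" using closed_sequentially[OF closed _ assms(2)] assms(1) in_L1 by blast
  show "u' \<in> L" using closed_sequentially[OF closed _ assms(3)] assms(1) in_L2 by blast
  show "\<forall>w w'. (w, w') \<in> \<Gamma> \<longrightarrow> inner w' u = inner w u'"
  proof (intro allI impI)
    fix w w' assume w: "(w, w') \<in> \<Gamma>"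
    have "(\<lambda>n. inner w' (f n)) \<longlonglongrightarrow> inner w' u" by (intro tendsto_intros assms)
    moreover have "(\<lambda>n. inner w (f' n)) \<longlonglongrightarrow> inner w u'" by (intro tendsto_intros assms)
    ultimately show "inner w' u = inner w u'"
      using symm[OF w assms(1)] by (simp add: LIMSEQ_unique)
  qed
qed

text \<open>The lower bound is used twice: it kills the orthogonal complement of the range, which
  consists of solutions of \<open>H z = t z\<close>, and it makes the preimages of a convergent
  sequence Cauchy, so that the range is closed.\<close>

lemma resolvent_exists:
  assumes "regular_at \<Gamma> t" and w: "w \<in> L"
  shows "\<exists>u. (u, w + t *\<^sub>R u) \<in> \<Gamma>"
proof -
  obtain c where c: "0 < c" "\<And>u u'. (u, u') \<in> \<Gamma> \<Longrightarrow> c * norm u \<le> norm (u' - t *\<^sub>R u)"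
    using regular_atE[OF assms(1)] by metis
  define M where "M = (\<lambda>(u, u'). u' - t *\<^sub>R u) ` \<Gamma>"
  have MI: "u' - t *\<^sub>R u \<in> M" if "(u, u') \<in> \<Gamma>" for u u' using that by (force simp: M_def)
  have M_le: "M \<subseteq> L"
    using subspace by (auto simp: M_def intro!: subspace_diff subspace_scale dest: in_L1 in_L2)
  have "subspace M"
  proof (rule subspaceI)
    show "0 \<in> M" using MI[OF graph_zero] by simp
    show "x + y \<in> M" if xy: "x \<in> M" "y \<in> M" for x y
    proof -
      obtain u u' v v' where "(u, u') \<in> \<Gamma>" "x = u' - t *\<^sub>R u" "(v, v') \<in> \<Gamma>" "y = v' - t *\<^sub>R v"
        using xy by (auto simp: M_def)
      moreover from this have "x + y = (u' + v') - t *\<^sub>R (u + v)" by (simp only: scaleR_add_right) simp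
      ultimately show ?thesis using MI[OF graph_add] by metis
    qed
    show "a *\<^sub>R x \<in> M" if x: "x \<in> M" for a x
    proof -
      obtain u u' where "(u, u') \<in> \<Gamma>" "x = u' - t *\<^sub>R u" using x by (auto simp: M_def)
      moreover from this have "a *\<^sub>R x = a *\<^sub>R u' - t *\<^sub>R (a *\<^sub>R u)"
        by (simp only: scaleR_diff_right scaleR_left_commute)
      ultimately show ?thesis using MI[OF graph_scale] by metis
    qed
  qed
  have "w \<in> closure M"
  proof (rule in_closure_if_orthogonal[OF \<open>subspace M\<close> M_le subspace closed w])
    fix z assume z: "z \<in> L" "\<And>m. m \<in> M \<Longrightarrow> inner z m = 0"
    have "(z, t *\<^sub>R z) \<in> \<Gamma>"
    proof (subst self_adjoint[OF z(1) subspace_scale[OF subspace z(1)]], intro allI impI)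
      fix u u' assume "(u, u') \<in> \<Gamma>"
      then have "inner z (u' - t *\<^sub>R u) = 0" using MI z(2) by blast
      then show "inner u' z = inner u (t *\<^sub>R z)" by (simp add: inner_diff inner_commute)
    qed
    from c(2)[OF this] c(1) show "z = 0" by (simp add: mult_le_0_iff)
  qed
  then obtain f where f: "\<And>n. f n \<in> M" "f \<longlonglongrightarrow> w" by (auto simp: closure_sequential)
  have "\<exists>u u'. (u, u') \<in> \<Gamma> \<and> f n = u' - t *\<^sub>R u" for n
    using f(1)[of n] by (auto simp: M_def)
  then obtain u u' where u: "\<And>n. (u n, u' n) \<in> \<Gamma>" "\<And>n. f n = u' n - t *\<^sub>R u n"
    by metis
  have "Cauchy u"
  proof (rule metric_CauchyI)
    fix e :: real assume "e > 0"
    then have "c * e > 0" using c by simp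
    then obtain N where N: "\<And>m n. m \<ge> N \<Longrightarrow> n \<ge> N \<Longrightarrow> dist (f m) (f n) < c * e"
      using LIMSEQ_imp_Cauchy[OF f(2)] by (meson metric_CauchyD)
    show "\<exists>M. \<forall>m\<ge>M. \<forall>n\<ge>M. dist (u m) (u n) < e"
    proof (intro exI[of _ N] allI impI)
      fix m n assume "N \<le> m" "N \<le> n"
      have "c * norm (u m - u n) \<le> norm (f m - f n)"
        using c(2)[OF graph_diff[OF u(1) u(1), of m n]] by (simp add: u(2) algebra_simps)
      also have "\<dots> < c * e" using N[OF \<open>N \<le> m\<close> \<open>N \<le> n\<close>] by (simp add: dist_norm)
      finally show "dist (u m) (u n) < e" using c(1) by (simp add: dist_norm)
    qed
  qed
  then obtain x where x: "u \<longlonglongrightarrow> x" using Cauchy_convergent convergent_def by blast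
  have "(\<lambda>n. f n + t *\<^sub>R u n) \<longlonglongrightarrow> w + t *\<^sub>R x" by (intro tendsto_intros f x)
  then have "u' \<longlonglongrightarrow> w + t *\<^sub>R x" by (simp add: u(2))
  with graph_limit[OF u(1) x] show ?thesis by blast
qed

text \<open>Passing to the resolvent at a real point outside the countable spectrum reduces the
  unbounded case to the bounded one.\<close>
theorem eigenvectors_total:
  assumes count: "countable (spec \<Gamma>)"
  shows "L \<subseteq> closure (span (eigenvecs \<Gamma>))"
proof -
  have "spec \<Gamma> \<noteq> UNIV" using count uncountable_UNIV_real by metis
  then obtain a where a: "regular_at \<Gamma> a" by (auto simp: spec_def)
  then obtain c where c: "0 < c" "\<And>u u'. (u, u') \<in> \<Gamma> \<Longrightarrow> c * norm u \<le> norm (u' - a *\<^sub>R u)"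
    using regular_atE by metis
  obtain R where R: "\<And>w. w \<in> L \<Longrightarrow> (R w, w + a *\<^sub>R R w) \<in> \<Gamma>"
    using resolvent_exists[OF a] by metis
  have unique: "R w = u" if "w \<in> L" "(u, w + a *\<^sub>R u) \<in> \<Gamma>" for w u
    using c(2)[OF graph_diff[OF R[OF that(1)] that(2)]] c(1)
    by (simp add: algebra_simps mult_le_0_iff)
  interpret R: bounded_symmetric L R
  proof
    show "subspace L" "closed L" by (fact subspace closed)+
    show "R u \<in> L" if "u \<in> L" for u using R[OF that] in_L1 by blast
    show "R (u + w) = R u + R w" if "u \<in> L" "w \<in> L" for u w
      using graph_add[OF R R, OF that] that
      by (intro unique) (auto simp: subspace_add[OF subspace] algebra_simps)
    show "R (t *\<^sub>R u) = t *\<^sub>R R u" if "u \<in> L" for t u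
      using graph_scale[OF R[OF that], of t] that
      by (intro unique) (auto simp: subspace_scale[OF subspace] algebra_simps)
    show "inner (R u) w = inner u (R w)" if "u \<in> L" "w \<in> L" for u w
      using symm[OF R R, OF that] by (simp add: inner_add)
    show "\<exists>K. \<forall>u\<in>L. norm (R u) \<le> K * norm u"
      using c(2)[OF R] c(1) by (intro exI[of _ "1/c"]) (auto simp: field_simps)
  qed
  have "spec R.graph \<subseteq> insert 0 ((\<lambda>y. 1 / (y - a)) ` spec \<Gamma>)"
  proof
    fix t assume t: "t \<in> spec R.graph"
    show "t \<in> insert 0 ((\<lambda>y. 1 / (y - a)) ` spec \<Gamma>)"
    proof (rule ccontr)
      assume neg: "\<not> ?thesis"
      then have t0: "t \<noteq> 0" by auto
      define y where "y = a + 1 / t"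
      have "y \<notin> spec \<Gamma>" using neg t0 by (auto simp: y_def image_iff)
      then have "regular_at \<Gamma> y" by (simp add: spec_def)
      then obtain k where k: "0 < k" "\<And>u u'. (u, u') \<in> \<Gamma> \<Longrightarrow> k * norm u \<le> norm (u' - y *\<^sub>R u)"
        using regular_atE by metis
      have "regular_at R.graph t"
      proof (rule regular_atI)
        \<comment> \<open>This constant comes from combining
          \<open>\<bar>t\<bar> * norm w \<le> norm u + norm r\<close> with
          \<open>norm u \<le> norm r / (\<bar>t\<bar> * k)\<close>.\<close>
        show "\<bar>t\<bar> / (1 / (\<bar>t\<bar> * k) + 1) > 0"
          using t0 k(1) by (intro divide_pos_pos add_pos_pos) auto
        fix w u assume "(w, u) \<in> R.graph"
        then have w: "w \<in> L" "u = R w" by auto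
        define r where "r = u - t *\<^sub>R w"
        have "k * norm u \<le> norm (w + a *\<^sub>R u - y *\<^sub>R u)" using k(2)[OF R[OF w(1)]] by (simp add: w)
        also have "w + a *\<^sub>R u - y *\<^sub>R u = (- 1 / t) *\<^sub>R r"
          using t0 by (simp add: y_def r_def algebra_simps)
        finally have u: "norm u \<le> norm r / (\<bar>t\<bar> * k)" using k(1) t0 by (simp add: field_simps)
        have "\<bar>t\<bar> * norm w = norm (u - r)" by (simp add: r_def)
        also have "\<dots> \<le> norm u + norm r" by (rule norm_triangle_ineq4)
        also have "\<dots> \<le> (1 / (\<bar>t\<bar> * k) + 1) * norm r" using u by (simp add: algebra_simps)
        finally have "\<bar>t\<bar> * norm w \<le> (1 / (\<bar>t\<bar> * k) + 1) * norm r" .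
        moreover have "1 / (\<bar>t\<bar> * k) + 1 > 0" using t0 k(1) by (intro add_pos_pos) auto
        ultimately show "\<bar>t\<bar> / (1 / (\<bar>t\<bar> * k) + 1) * norm w \<le> norm (u - t *\<^sub>R w)"
          unfolding r_def[symmetric] by (simp add: pos_divide_le_eq mult.commute)
      qed
      with t show False by (simp add: spec_def)
    qed
  qed
  then have "countable (spec R.graph)" by (rule countable_subset) (intro countable_insert countable_image count)
  then have total: "L \<subseteq> closure (span (eigenvecs R.graph))" by (rule R.eigenvectors_total)
  have "eigenvecs R.graph \<subseteq> eigenvecs \<Gamma>"
  proof
    fix w assume "w \<in> eigenvecs R.graph"
    then obtain t where w: "w \<in> L" "R w = t *\<^sub>R w"
      by (auto simp: eigenvecs_def) metis
    have g: "(t *\<^sub>R w, w + a *\<^sub>R (t *\<^sub>R w)) \<in> \<Gamma>" using R[OF w(1)] w(2) by simp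
    show "w \<in> eigenvecs \<Gamma>"
    proof (cases "t = 0")
      \<comment> \<open>The graph would contain the pair \<open>(0, w)\<close>, so the inverse has
        trivial kernel.\<close>
      case True
      then have "w = 0" using g single_valued by simp
      then show ?thesis using graph_zero by (auto simp: eigenvecs_def)
    next
      case False
      then have "(w, (1 / t + a) *\<^sub>R w) \<in> \<Gamma>"
        using graph_scale[OF g, of "1 / t"] by (simp add: algebra_simps)
      then show ?thesis by (auto simp: eigenvecs_def)
    qed
  qed
  then have "closure (span (eigenvecs R.graph)) \<subseteq> closure (span (eigenvecs \<Gamma>))"
    by (intro closure_mono span_mono)
  with total show ?thesis by (rule order_trans)
qed

end

section \<open>Square-summable functions\<close>

lemma sq_sum_le: "(a + b)\<^sup>2 \<le> 2 * a\<^sup>2 + 2 * (b::real)\<^sup>2"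
  using zero_le_power2[of "a - b"] by (simp add: power2_eq_square algebra_simps)

lemma nonneg_summable_on_le:
  fixes f g :: "'a \<Rightarrow> real"
  assumes "g summable_on A" "\<And>x. x \<in> A \<Longrightarrow> 0 \<le> f x" "\<And>x. x \<in> A \<Longrightarrow> f x \<le> g x"
  shows "f summable_on A"
proof -
  have "(\<lambda>x. norm (g x)) summable_on A" using assms(1) summable_on_iff_abs_summable_on_real by blast
  then have "(\<lambda>x. norm (f x)) summable_on A"
    by (rule Infinite_Sum.abs_summable_on_comparison_test) (use assms(2,3) in force)
  then show ?thesis using summable_on_iff_abs_summable_on_real by blast
qed

text \<open>The index type is arbitrary; particle sets are singled out later by supports, so that
  all clusters live in one space.\<close>

typedef 'a l2 = "{f :: 'a \<Rightarrow> real. (\<lambda>x. (f x)\<^sup>2) summable_on UNIV}"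
  morphisms ap Abs_l2
  by (rule exI[of _ "\<lambda>_. 0"]) simp

setup_lifting type_definition_l2

lemma ap_summable: "(\<lambda>x. (ap u x)\<^sup>2) summable_on UNIV"
  using ap[of u] by simp

lemma ap_mult_summable: "(\<lambda>x. ap u x * ap w x) summable_on UNIV"
proof -
  have "(\<lambda>x. (ap u x)\<^sup>2 + (ap w x)\<^sup>2) summable_on UNIV" by (intro summable_on_add ap_summable)
  moreover have "\<bar>ap u x * ap w x\<bar> \<le> (ap u x)\<^sup>2 + (ap w x)\<^sup>2" for x
  proof -
    have "2 * (\<bar>ap u x\<bar> * \<bar>ap w x\<bar>) \<le> (ap u x)\<^sup>2 + (ap w x)\<^sup>2"
      using zero_le_power2[of "\<bar>ap u x\<bar> - \<bar>ap w x\<bar>"] by (simp add: power2_diff)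
    moreover have "0 \<le> \<bar>ap u x\<bar> * \<bar>ap w x\<bar>" by simp
    ultimately show ?thesis unfolding abs_mult by linarith
  qed
  ultimately have "(\<lambda>x. norm (ap u x * ap w x)) summable_on UNIV"
    by (auto intro: nonneg_summable_on_le[of "\<lambda>x. (ap u x)\<^sup>2 + (ap w x)\<^sup>2"])
  then show ?thesis using summable_on_iff_abs_summable_on_real by blast
qed

lemma l2_eqI: "(\<And>x. ap u x = ap w x) \<Longrightarrow> u = w"
  by (simp add: ap_inject[symmetric] fun_eq_iff)

instantiation l2 :: (type) real_vector
begin

lift_definition zero_l2 :: "'a l2" is "\<lambda>_. 0" by simp

lift_definition plus_l2 :: "'a l2 \<Rightarrow> 'a l2 \<Rightarrow> 'a l2" is "\<lambda>f g x. f x + g x"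
proof -
  fix f g :: "'a \<Rightarrow> real"
  assume "(\<lambda>x. (f x)\<^sup>2) summable_on UNIV" "(\<lambda>x. (g x)\<^sup>2) summable_on UNIV"
  then have "(\<lambda>x. 2 * (f x)\<^sup>2 + 2 * (g x)\<^sup>2) summable_on UNIV"
    by (intro summable_on_add summable_on_cmult_right)
  then show "(\<lambda>x. (f x + g x)\<^sup>2) summable_on UNIV"
    by (rule nonneg_summable_on_le) (simp_all add: sq_sum_le)
qed

lift_definition scaleR_l2 :: "real \<Rightarrow> 'a l2 \<Rightarrow> 'a l2" is "\<lambda>c f x. c * f x"
  by (simp add: power_mult_distrib summable_on_cmult_right)

lift_definition uminus_l2 :: "'a l2 \<Rightarrow> 'a l2" is "\<lambda>f x. - f x" by simp

lift_definition minus_l2 :: "'a l2 \<Rightarrow> 'a l2 \<Rightarrow> 'a l2" is "\<lambda>f g x. f x - g x"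
proof -
  fix f g :: "'a \<Rightarrow> real"
  assume "(\<lambda>x. (f x)\<^sup>2) summable_on UNIV" "(\<lambda>x. (g x)\<^sup>2) summable_on UNIV"
  then have "(\<lambda>x. 2 * (f x)\<^sup>2 + 2 * (g x)\<^sup>2) summable_on UNIV"
    by (intro summable_on_add summable_on_cmult_right)
  then show "(\<lambda>x. (f x - g x)\<^sup>2) summable_on UNIV"
  proof (rule nonneg_summable_on_le)
    show "(f x - g x)\<^sup>2 \<le> 2 * (f x)\<^sup>2 + 2 * (g x)\<^sup>2" for x
      using sq_sum_le[of "f x" "- g x"] by simp
  qed simp
qed

instance
  by standard (rule l2_eqI; simp add: zero_l2.rep_eq plus_l2.rep_eq minus_l2.rep_eq
      scaleR_l2.rep_eq uminus_l2.rep_eq algebra_simps)+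

end

lemma ap_zero [simp]: "ap 0 x = 0" by transfer simp
lemma ap_add [simp]: "ap (u + w) x = ap u x + ap w x" by transfer simp
lemma ap_scaleR [simp]: "ap (c *\<^sub>R u) x = c * ap u x" by transfer simp
lemma ap_uminus [simp]: "ap (- u) x = - ap u x" by transfer simp
lemma ap_diff [simp]: "ap (u - w) x = ap u x - ap w x" by transfer simp
lemma ap_sum [simp]: "ap (sum f A) x = (\<Sum>i\<in>A. ap (f i) x)"
  by (induction A rule: infinite_finite_induct) auto

instantiation l2 :: (type) real_inner
begin

definition inner_l2 :: "'a l2 \<Rightarrow> 'a l2 \<Rightarrow> real"
  where "inner_l2 u w = (\<Sum>\<^sub>\<infinity>x. ap u x * ap w x)"
definition norm_l2 :: "'a l2 \<Rightarrow> real" where "norm_l2 u = sqrt (inner u u)"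
definition sgn_l2 :: "'a l2 \<Rightarrow> 'a l2" where "sgn_l2 u = u /\<^sub>R norm u"
definition dist_l2 :: "'a l2 \<Rightarrow> 'a l2 \<Rightarrow> real" where "dist_l2 u w = norm (u - w)"
definition uniformity_l2 :: "('a l2 \<times> 'a l2) filter"
  where "uniformity_l2 = (INF e\<in>{0<..}. principal {(x, y). dist x y < e})"
definition open_l2 :: "'a l2 set \<Rightarrow> bool"
  where "open_l2 U = (\<forall>x\<in>U. \<forall>\<^sub>F (x', y) in uniformity. x' = x \<longrightarrow> y \<in> U)"

instance
proof
  fix u w z :: "'a l2" and r :: real
  show "inner u w = inner w u" by (simp add: inner_l2_def mult.commute)
  show "inner (u + w) z = inner u z + inner w z"
    by (simp add: inner_l2_def distrib_right infsum_add ap_mult_summable)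
  show "inner (r *\<^sub>R u) w = r * inner u w"
    by (simp add: inner_l2_def mult.assoc infsum_cmult_right ap_mult_summable)
  show "0 \<le> inner u u" by (simp add: inner_l2_def infsum_nonneg)
  show "inner u u = 0 \<longleftrightarrow> u = 0"
  proof
    assume "inner u u = 0"
    then have "(ap u x)\<^sup>2 = 0" for x
      using nonneg_infsum_le_0D[of "\<lambda>x. (ap u x)\<^sup>2" UNIV x] ap_summable[of u]
      by (simp add: inner_l2_def power2_eq_square)
    then show "u = 0" by (intro l2_eqI) simp
  qed (simp add: inner_l2_def)
qed (simp_all add: norm_l2_def sgn_l2_def dist_l2_def uniformity_l2_def open_l2_def)

end

lemma norm_l2_sq: "(norm u)\<^sup>2 = (\<Sum>\<^sub>\<infinity>x. (ap u x)\<^sup>2)"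
  unfolding power2_norm_eq_inner inner_l2_def by (simp add: power2_eq_square)

lemma sum_sq_le_norm: "finite F \<Longrightarrow> (\<Sum>x\<in>F. (ap u x)\<^sup>2) \<le> (norm u)\<^sup>2"
  unfolding norm_l2_sq by (intro finite_sum_le_infsum ap_summable) auto

lemma ap_le_norm: "\<bar>ap u x\<bar> \<le> norm u"
  by (rule power2_le_imp_le) (use sum_sq_le_norm[of "{x}" u] in auto)

lemma norm_l2_le_if_sums:
  fixes u :: "'a l2"
  assumes "\<And>F. finite F \<Longrightarrow> (\<Sum>x\<in>F. (ap u x)\<^sup>2) \<le> b\<^sup>2" "0 \<le> b"
  shows "norm u \<le> b"
proof -
  have "(norm u)\<^sup>2 \<le> b\<^sup>2" unfolding norm_l2_sq
    by (intro infsum_le_finite_sums ap_summable) (use assms in auto)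
  then show ?thesis using assms(2) by (rule power2_le_imp_le)
qed

lemma norm_l2_le:
  fixes u w :: "'a l2"
  assumes "\<And>x. \<bar>ap u x\<bar> \<le> c * \<bar>ap w x\<bar>" "0 \<le> c"
  shows "norm u \<le> c * norm w"
proof (rule norm_l2_le_if_sums)
  fix F :: "'a set" assume "finite F"
  have "(ap u x)\<^sup>2 \<le> c\<^sup>2 * (ap w x)\<^sup>2" for x
    using power_mono[OF assms(1), of x 2] by (simp add: power_mult_distrib)
  then have "(\<Sum>x\<in>F. (ap u x)\<^sup>2) \<le> c\<^sup>2 * (\<Sum>x\<in>F. (ap w x)\<^sup>2)"
    unfolding sum_distrib_left by (intro sum_mono)
  also have "\<dots> \<le> c\<^sup>2 * (norm w)\<^sup>2" using sum_sq_le_norm[OF \<open>finite F\<close>] by (intro mult_left_mono) auto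
  finally show "(\<Sum>x\<in>F. (ap u x)\<^sup>2) \<le> (c * norm w)\<^sup>2" by (simp add: power_mult_distrib)
qed (use assms(2) in auto)

text \<open>This takes the place of a partition of unity: the pieces only have to dominate
  \<open>u\<close> pointwise somewhere in the family, and they may overlap freely.\<close>

lemma norm_l2_le_cover:
  fixes u :: "'a l2"
  assumes "finite I" "\<And>x. \<exists>i\<in>I. \<bar>ap u x\<bar> \<le> \<bar>ap (f i) x\<bar>"
  shows "norm u \<le> (\<Sum>i\<in>I. norm (f i))"
proof (rule norm_l2_le_if_sums)
  fix F :: "'a set" assume F: "finite F"
  have "(ap u x)\<^sup>2 \<le> (\<Sum>i\<in>I. (ap (f i) x)\<^sup>2)" for x
  proof -
    obtain i where i: "i \<in> I" "\<bar>ap u x\<bar> \<le> \<bar>ap (f i) x\<bar>" using assms(2)[of x] by blast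
    then have "(ap u x)\<^sup>2 \<le> (ap (f i) x)\<^sup>2" by (simp add: abs_le_square_iff)
    also have "\<dots> \<le> (\<Sum>i\<in>I. (ap (f i) x)\<^sup>2)" using i(1) assms(1) by (intro member_le_sum) auto
    finally show ?thesis .
  qed
  then have "(\<Sum>x\<in>F. (ap u x)\<^sup>2) \<le> (\<Sum>x\<in>F. \<Sum>i\<in>I. (ap (f i) x)\<^sup>2)" by (intro sum_mono)
  also have "\<dots> = (\<Sum>i\<in>I. \<Sum>x\<in>F. (ap (f i) x)\<^sup>2)" by (rule sum.swap)
  also have "\<dots> \<le> (\<Sum>i\<in>I. (norm (f i))\<^sup>2)" by (intro sum_mono sum_sq_le_norm F)
  also have "\<dots> \<le> (\<Sum>i\<in>I. norm (f i))\<^sup>2"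
    using power_mono[OF L2_set_le_sum[of I "\<lambda>i. norm (f i)"], of 2]
    by (simp add: L2_set_def sum_nonneg)
  finally show "(\<Sum>x\<in>F. (ap u x)\<^sup>2) \<le> (\<Sum>i\<in>I. norm (f i))\<^sup>2" .
qed (simp add: sum_nonneg)

instance l2 :: (type) complete_space
proof
  fix X :: "nat \<Rightarrow> 'a l2" assume X: "Cauchy X"
  have "Cauchy (\<lambda>n. ap (X n) x)" for x
  proof (rule metric_CauchyI)
    fix e :: real assume "e > 0"
    then obtain M where "\<And>m n. m \<ge> M \<Longrightarrow> n \<ge> M \<Longrightarrow> dist (X m) (X n) < e"
      using metric_CauchyD[OF X] by blast
    moreover have "dist (ap (X m) x) (ap (X n) x) \<le> dist (X m) (X n)" for m n
      using ap_le_norm[of "X m - X n" x] by (simp add: dist_norm)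
    ultimately show "\<exists>M. \<forall>m\<ge>M. \<forall>n\<ge>M. dist (ap (X m) x) (ap (X n) x) < e"
      by (meson order_le_less_trans)
  qed
  then have "\<exists>l. (\<lambda>n. ap (X n) x) \<longlonglongrightarrow> l" for x
    using Cauchy_convergent convergent_def by blast
  then obtain l where l: "\<And>x. (\<lambda>n. ap (X n) x) \<longlonglongrightarrow> l x" by metis
  have tail: "(\<Sum>x\<in>F. (ap (X n) x - l x)\<^sup>2) \<le> e\<^sup>2"
    if "finite F" "0 < e" "\<And>m. m \<ge> M \<Longrightarrow> dist (X n) (X m) < e" for F n M e
  proof (rule LIMSEQ_le_const2)
    show "(\<lambda>m. \<Sum>x\<in>F. (ap (X n) x - ap (X m) x)\<^sup>2) \<longlonglongrightarrow> (\<Sum>x\<in>F. (ap (X n) x - l x)\<^sup>2)"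
      by (intro tendsto_intros l)
    have "(\<Sum>x\<in>F. (ap (X n) x - ap (X m) x)\<^sup>2) \<le> e\<^sup>2" if "m \<ge> M" for m
    proof -
      have "(\<Sum>x\<in>F. (ap (X n) x - ap (X m) x)\<^sup>2) \<le> (norm (X n - X m))\<^sup>2"
        using sum_sq_le_norm[OF \<open>finite F\<close>, of "X n - X m"] by simp
      also have "\<dots> \<le> e\<^sup>2"
        using \<open>\<And>m. m \<ge> M \<Longrightarrow> dist (X n) (X m) < e\<close>[OF that] by (intro power_mono) (auto simp: dist_norm)
      finally show ?thesis .
    qed
    then show "\<exists>N. \<forall>m\<ge>N. (\<Sum>x\<in>F. (ap (X n) x - ap (X m) x)\<^sup>2) \<le> e\<^sup>2" by blast
  qed
  obtain M where M: "\<And>m n. m \<ge> M \<Longrightarrow> n \<ge> M \<Longrightarrow> dist (X m) (X n) < 1"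
    using metric_CauchyD[OF X zero_less_one] by blast
  \<comment> \<open>The Cauchy property bounds differences, so the pointwise limit is reached as
    \<open>X M\<close> minus the square-summable difference \<open>d\<close>.\<close>
  have "(\<lambda>x. (ap (X M) x - l x)\<^sup>2) summable_on UNIV"
  proof (rule nonneg_bdd_above_summable_on)
    show "bdd_above (sum (\<lambda>x. (ap (X M) x - l x)\<^sup>2) ` {F. F \<subseteq> UNIV \<and> finite F})"
      using tail[of _ 1 M M] M by (intro bdd_aboveI[of _ 1]) auto
  qed auto
  then have inv: "ap (Abs_l2 (\<lambda>x. ap (X M) x - l x)) = (\<lambda>x. ap (X M) x - l x)"
    by (intro Abs_l2_inverse) simp
  define d where "d = Abs_l2 (\<lambda>x. ap (X M) x - l x)"
  have d: "ap d x = ap (X M) x - l x" for x unfolding d_def inv ..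
  define w where "w = X M - d"
  have w: "ap w x = l x" for x by (simp add: w_def d)
  have "X \<longlonglongrightarrow> w"
  proof (rule metric_LIMSEQ_I)
    fix e :: real assume "e > 0"
    then obtain N where N: "\<And>m n. m \<ge> N \<Longrightarrow> n \<ge> N \<Longrightarrow> dist (X m) (X n) < e / 2"
      using metric_CauchyD[OF X half_gt_zero] by blast
    have "dist (X n) w < e" if "n \<ge> N" for n
    proof -
      have "norm (X n - w) \<le> e / 2"
        using tail[of _ "e / 2" N n] N that \<open>e > 0\<close> by (intro norm_l2_le_if_sums) (auto simp: w)
      then show ?thesis using \<open>e > 0\<close> by (simp add: dist_norm)
    qed
    then show "\<exists>N. \<forall>n\<ge>N. dist (X n) w < e" by blast
  qed
  then show "convergent X" by (auto simp: convergent_def)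
qed

lemma tendsto_ap:
  assumes "X \<longlonglongrightarrow> u" shows "(\<lambda>n. ap (X n) x) \<longlonglongrightarrow> ap u x"
proof (rule LIM_zero_cancel, rule Lim_null_comparison)
  show "\<forall>\<^sub>F n in sequentially. norm (ap (X n) x - ap u x) \<le> norm (X n - u)"
    using ap_le_norm[of "X _ - u" x] by simp
  show "(\<lambda>n. norm (X n - u)) \<longlonglongrightarrow> 0" using assms by (simp add: LIM_zero_iff tendsto_norm_zero_iff)
qed

lift_definition delta :: "'a \<Rightarrow> 'a l2" is "\<lambda>a x. if x = a then 1 else 0"
proof -
  fix a :: 'a
  have "(\<lambda>x. (if x = a then 1 else 0 :: real)\<^sup>2) summable_on {a}" by simp
  moreover have "(\<lambda>x. (if x = a then 1 else 0 :: real)\<^sup>2) summable_on UNIV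
      \<longleftrightarrow> (\<lambda>x. (if x = a then 1 else 0 :: real)\<^sup>2) summable_on {a}"
    by (rule summable_on_cong_neutral) auto
  ultimately show "(\<lambda>x. (if x = a then 1 else 0 :: real)\<^sup>2) summable_on UNIV" by blast
qed

lemma ap_delta: "ap (delta a) x = (if x = a then 1 else 0)"
  by transfer simp

lemma inner_delta: "inner (delta a) u = ap u a"
proof -
  have "inner (delta a) u = (\<Sum>\<^sub>\<infinity>x\<in>{a}. ap u x)"
    unfolding inner_l2_def by (rule infsum_cong_neutral) (auto simp: ap_delta)
  then show ?thesis by simp
qed

text \<open>Made total by sending unbounded multipliers to the zero operator. The unbounded field
  term therefore appears pointwise in \<open>ham\<close> and not through \<open>mul\<close>.\<close>

lift_definition mul :: "('a \<Rightarrow> real) \<Rightarrow> 'a l2 \<Rightarrow> 'a l2"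
  is "\<lambda>m f. if bounded (range m) then (\<lambda>x. m x * f x) else (\<lambda>_. 0)"
proof -
  fix m f :: "'a \<Rightarrow> real"
  assume f: "(\<lambda>x. (f x)\<^sup>2) summable_on UNIV"
  show "(\<lambda>x. ((if bounded (range m) then (\<lambda>x. m x * f x) else (\<lambda>_. 0)) x)\<^sup>2) summable_on UNIV"
  proof (cases "bounded (range m)")
    case True
    then obtain B where B: "\<And>x. \<bar>m x\<bar> \<le> B" unfolding bounded_iff by auto
    have "(\<lambda>x. B\<^sup>2 * (f x)\<^sup>2) summable_on UNIV" using f by (rule summable_on_cmult_right)
    then have "(\<lambda>x. (m x * f x)\<^sup>2) summable_on UNIV"
    proof (rule nonneg_summable_on_le)
      show "(m x * f x)\<^sup>2 \<le> B\<^sup>2 * (f x)\<^sup>2" for x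
        unfolding power_mult_distrib using power_mono[OF B[of x], of 2] by (intro mult_right_mono) auto
    qed auto
    then show ?thesis using True by simp
  qed simp
qed

lemma ap_mul: "bounded (range m) \<Longrightarrow> ap (mul m u) x = m x * ap u x"
  by transfer simp

lemma norm_mul_le:
  assumes "\<And>x. \<bar>m x\<bar> \<le> B" shows "norm (mul m u) \<le> B * norm u"
proof (rule norm_l2_le)
  have "bounded (range m)" using assms by (auto simp: bounded_iff)
  then show "\<bar>ap (mul m u) x\<bar> \<le> B * \<bar>ap u x\<bar>" for x
    using assms[of x] by (simp add: ap_mul abs_mult mult_right_mono)
  show "0 \<le> B" using assms abs_ge_zero order_trans by blast
qed

lift_definition reindex :: "('a \<Rightarrow> 'a) \<Rightarrow> 'a l2 \<Rightarrow> 'a l2"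
  is "\<lambda>p f. if bij p then (\<lambda>x. f (p x)) else (\<lambda>_. 0)"
proof -
  fix p :: "'a \<Rightarrow> 'a" and f :: "'a \<Rightarrow> real"
  assume f: "(\<lambda>x. (f x)\<^sup>2) summable_on UNIV"
  show "(\<lambda>x. ((if bij p then (\<lambda>x. f (p x)) else (\<lambda>_. 0)) x)\<^sup>2) summable_on UNIV"
    using f summable_on_reindex_bij_betw[of p UNIV UNIV "\<lambda>x. (f x)\<^sup>2"] by auto
qed

lemma ap_reindex: "bij p \<Longrightarrow> ap (reindex p u) x = ap u (p x)"
  by transfer simp

lemma norm_reindex: "bij p \<Longrightarrow> norm (reindex p u) = norm u"
proof -
  assume p: "bij p"
  have "(norm (reindex p u))\<^sup>2 = (norm u)\<^sup>2"
    unfolding norm_l2_sq ap_reindex[OF p] by (rule infsum_reindex_bij_betw[of p UNIV UNIV, OF p])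
  then show ?thesis by simp
qed

lemma inner_reindex:
  assumes "bij p" "bij q" "\<And>x. q (p x) = x"
  shows "inner (reindex p u) w = inner u (reindex q w)"
  unfolding inner_l2_def ap_reindex[OF assms(1)] ap_reindex[OF assms(2)]
  using infsum_reindex_bij_betw[of p UNIV UNIV "\<lambda>y. ap u y * ap w (q y)"] assms by simp

definition supp_in :: "'a set \<Rightarrow> 'a l2 set" where
  "supp_in A = {u. \<forall>x. x \<notin> A \<longrightarrow> ap u x = 0}"

lemma subspace_supp_in: "subspace (supp_in A)"
  by (auto simp: subspace_def supp_in_def)

lemma closed_supp_in: "closed (supp_in A)"
  unfolding closed_sequential_limits
proof safe
  fix X :: "nat \<Rightarrow> 'a l2" and u assume X: "\<forall>n. X n \<in> supp_in A" "X \<longlonglongrightarrow> u"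
  have "ap u x = 0" if "x \<notin> A" for x
    using tendsto_ap[OF X(2), of x] X(1) that by (simp add: supp_in_def LIMSEQ_const_iff)
  then show "u \<in> supp_in A" by (simp add: supp_in_def)
qed

lemma supp_in_subset_closure_deltas: "supp_in A \<subseteq> closure (span (delta ` A))"
proof
  fix u assume "u \<in> supp_in A"
  then show "u \<in> closure (span (delta ` A))"
  proof (rule in_closure_if_orthogonal[OF subspace_span _ subspace_supp_in closed_supp_in, rotated])
    show "span (delta ` A) \<subseteq> supp_in A"
      by (intro span_minimal subspace_supp_in) (auto simp: supp_in_def ap_delta)
    fix z :: "'a l2" assume z: "z \<in> supp_in A" "\<And>m. m \<in> span (delta ` A) \<Longrightarrow> inner z m = 0"
    show "z = 0"
    proof (rule l2_eqI)
      fix x show "ap z x = ap 0 x"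
      proof (cases "x \<in> A")
        case True
        then have "inner z (delta x) = 0" by (intro z(2) span_base) auto
        then show ?thesis by (metis inner_commute inner_delta ap_zero)
      qed (use z(1) in \<open>auto simp: supp_in_def\<close>)
    qed
  qed
qed

section \<open>The Hamiltonian and its cluster decompositions\<close>

text \<open>For \<open>I = {..<N}\<close> this is \<open>config N\<close>. Arbitrary label sets
  allow the particles of a cluster to keep their labels.\<close>

definition conf :: "nat set \<Rightarrow> (nat \<Rightarrow> int) set" where
  "conf I = {x. \<forall>k. k \<notin> I \<longrightarrow> x k = 0}"

lemma conf_upd: "k \<in> I \<Longrightarrow> x(k := a) \<in> conf I \<longleftrightarrow> x \<in> conf I"
  by (auto simp: conf_def)

lemma countable_conf:
  assumes "finite I" shows "countable (conf I)"
proof -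
  have "inj_on (\<lambda>x. restrict x I) (conf I)"
  proof (rule inj_onI)
    fix x y assume "x \<in> conf I" "y \<in> conf I" "restrict x I = restrict y I"
    then show "x = y" unfolding conf_def by (auto simp: fun_eq_iff restrict_def) metis
  qed
  moreover have "countable (PiE I (\<lambda>_. UNIV :: int set))"
    using assms by (intro countable_PiE) auto
  then have "countable ((\<lambda>x. restrict x I) ` conf I)" by (rule countable_subset[rotated]) auto
  ultimately show ?thesis by (rule countable_image_inj_on[rotated])
qed

definition shift :: "nat \<Rightarrow> int \<Rightarrow> (nat \<Rightarrow> int) l2 \<Rightarrow> (nat \<Rightarrow> int) l2" where
  "shift k s = reindex (\<lambda>x. x(k := x k + s))"

lemma bij_upd_add: "bij (\<lambda>x :: nat \<Rightarrow> int. x(k := x k + s))"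
  by (rule bij_betw_byWitness[where f' = "\<lambda>x. x(k := x k - s)"]) auto

lemma ap_shift: "ap (shift k s u) x = ap u (x(k := x k + s))"
  by (simp add: shift_def ap_reindex bij_upd_add)

lemma norm_shift: "norm (shift k s u) = norm u"
  by (simp add: shift_def norm_reindex bij_upd_add)

lemma inner_shift: "inner (shift k s u) w = inner u (shift k (- s) w)"
  unfolding shift_def by (rule inner_reindex[OF bij_upd_add bij_upd_add]) simp

definition hop :: "real \<Rightarrow> nat set \<Rightarrow> (nat \<Rightarrow> int) l2 \<Rightarrow> (nat \<Rightarrow> int) l2" where
  "hop g I u = (\<Sum>k\<in>I. (- g) *\<^sub>R (shift k 1 u + shift k (- 1) u))"

definition coord_sum :: "nat set \<Rightarrow> (nat \<Rightarrow> int) \<Rightarrow> real" where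
  "coord_sum I x = real_of_int (\<Sum>k\<in>I. x k)"

text \<open>The domain is implicit and maximal: \<open>u\<close> belongs to it exactly if the
  pointwise expression is square-summable. The free parameter \<open>W\<close> covers both the full
  and the decoupled interactions.\<close>

definition ham :: "real \<Rightarrow> real \<Rightarrow> nat set \<Rightarrow> ((nat \<Rightarrow> int) \<Rightarrow> real)
    \<Rightarrow> ((nat \<Rightarrow> int) l2 \<times> (nat \<Rightarrow> int) l2) set" where
  "ham g h I W = {(u, u'). u \<in> supp_in (conf I) \<and> u' \<in> supp_in (conf I) \<and>
     (\<forall>x. ap u' x = ap (hop g I u) x + (W x - 2 * h * coord_sum I x) * ap u x)}"

lemma ap_hop: "ap (hop g I u) x = (\<Sum>k\<in>I. - g * (ap u (x(k := x k + 1)) + ap u (x(k := x k - 1))))"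
  by (simp add: hop_def ap_shift)

lemma hop_supp_in: "u \<in> supp_in (conf I) \<Longrightarrow> hop g I u \<in> supp_in (conf I)"
  unfolding supp_in_def by (auto simp: ap_hop conf_upd intro!: sum.neutral)

lemma norm_hop_le: "norm (hop g I u) \<le> 2 * \<bar>g\<bar> * real (card I) * norm u"
proof -
  have "norm (hop g I u) \<le> (\<Sum>k\<in>I. norm ((- g) *\<^sub>R (shift k 1 u + shift k (- 1) u)))"
    unfolding hop_def by (rule norm_sum)
  also have "\<dots> \<le> (\<Sum>k\<in>I. \<bar>g\<bar> * (norm u + norm u))"
    using norm_triangle_ineq[of "shift _ 1 u" "shift _ (- 1) u"]
    by (intro sum_mono) (auto simp: norm_shift intro!: mult_left_mono)
  finally show ?thesis by (simp add: algebra_simps)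
qed

lemma inner_hop: "inner (hop g I u) w = inner u (hop g I w)"
  by (simp add: hop_def inner_sum_left inner_sum_right inner_add inner_shift add.commute)

lemma ham_symm:
  assumes "(u, u') \<in> ham g h I W" "(w, w') \<in> ham g h I W"
  shows "inner u' w = inner u w'"
proof -
  have u: "ap (u' - hop g I u) x = (W x - 2 * h * coord_sum I x) * ap u x" for x
    using assms(1) by (simp add: ham_def)
  have w: "ap (w' - hop g I w) x = (W x - 2 * h * coord_sum I x) * ap w x" for x
    using assms(2) by (simp add: ham_def)
  have "inner (u' - hop g I u) w = inner u (w' - hop g I w)"
    unfolding inner_l2_def u w by (simp add: mult_ac)
  then show ?thesis by (simp add: inner_diff inner_hop)
qed

text \<open>Beyond symmetry, the pairing with \<open>delta x\<close>, which lies in the domain for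
  \<open>x\<close> in \<open>conf I\<close>, returns the defining equation of \<open>ham\<close> at
  the point \<open>x\<close>.\<close>

lemma self_adjoint_ham: "self_adjoint_graph (supp_in (conf I)) (ham g h I W)"
proof
  let ?L = "supp_in (conf I)"
  show "subspace ?L" "closed ?L" by (fact subspace_supp_in closed_supp_in)+
  show "ham g h I W \<subseteq> ?L \<times> ?L" by (auto simp: ham_def)
  show "w = 0" if "(0, w) \<in> ham g h I W" for w
    using that by (intro l2_eqI) (auto simp: ham_def ap_hop)
  fix w w' assume w: "w \<in> ?L" "w' \<in> ?L"
  show "(w, w') \<in> ham g h I W \<longleftrightarrow> (\<forall>u u'. (u, u') \<in> ham g h I W \<longrightarrow> inner u' w = inner u w')"
  proof safe
    assume all: "\<forall>u u'. (u, u') \<in> ham g h I W \<longrightarrow> inner u' w = inner u w'"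
    have "ap w' x = ap (hop g I w) x + (W x - 2 * h * coord_sum I x) * ap w x" for x
    proof (cases "x \<in> conf I")
      case True
      let ?m = "W x - 2 * h * coord_sum I x"
      have d: "delta x \<in> ?L" using True by (auto simp: supp_in_def ap_delta)
      then have "hop g I (delta x) + ?m *\<^sub>R delta x \<in> ?L"
        using subspace_supp_in[of "conf I"] by (intro subspace_add subspace_scale hop_supp_in) auto
      with d have "(delta x, hop g I (delta x) + ?m *\<^sub>R delta x) \<in> ham g h I W"
        by (auto simp: ham_def ap_delta)
      with all have "inner (hop g I (delta x) + ?m *\<^sub>R delta x) w = inner (delta x) w'" by blast
      then show ?thesis by (simp add: inner_add inner_hop inner_delta)
    next
      case False
      then show ?thesis using w hop_supp_in[OF w(1), of g] by (simp add: supp_in_def)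
    qed
    with w show "(w, w') \<in> ham g h I W" by (simp add: ham_def)
  qed (rule ham_symm)
qed

text \<open>Moving all particles of \<open>I\<close> by \<open>n\<close> sites preserves hopping
  and, by assumption, \<open>W\<close>, while the field term changes by a constant. Transport along
  this norm-preserving map turns a lower bound at \<open>t + p\<close> into one at
  \<open>t\<close>.\<close>

lemma spec_ham_translate:
  assumes W: "\<And>x. W (\<lambda>k. if k \<in> I then x k + n else x k) = W x"
    and t: "t \<in> spec (ham g h I W)" and I: "finite I"
  shows "t + 2 * h * real (card I) * of_int n \<in> spec (ham g h I W)"
proof -
  define p where "p = 2 * h * real (card I) * of_int n"
  define \<tau> where "\<tau> m x = (\<lambda>k. if k \<in> I then x k + m else x k)" for m and x :: "nat \<Rightarrow> int"
  have bij: "bij (\<tau> m)" for m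
    by (rule bij_betw_byWitness[where f' = "\<tau> (- m)"]) (auto simp: \<tau>_def fun_eq_iff)
  have conf: "\<tau> m x \<in> conf I \<longleftrightarrow> x \<in> conf I" for m x by (auto simp: \<tau>_def conf_def)
  have tot: "coord_sum I (\<tau> n x) = coord_sum I x + real (card I) * of_int n" for x
    using I by (simp add: coord_sum_def \<tau>_def sum.distrib)
  have upd: "(\<tau> n x)(k := \<tau> n x k + s) = \<tau> n (x(k := x k + s))" if "k \<in> I" for k s x
    using that by (auto simp: \<tau>_def fun_eq_iff)
  have hop: "ap (hop g I u) (\<tau> n x) = ap (hop g I (reindex (\<tau> n) u)) x" for u x
    using upd[of _ x 1] upd[of _ x "-1"] by (simp add: ap_hop ap_reindex[OF bij])
  have "regular_at (ham g h I W) t" if reg: "regular_at (ham g h I W) (t + p)"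
  proof -
    obtain c where c: "0 < c"
      "\<And>u u'. (u, u') \<in> ham g h I W \<Longrightarrow> c * norm u \<le> norm (u' - (t + p) *\<^sub>R u)"
      using regular_atE[OF reg] by metis
    show ?thesis
    proof (rule regular_atI[OF c(1)])
      fix u u' assume u: "(u, u') \<in> ham g h I W"
      let ?r = "reindex (\<tau> n)"
      have r: "ap (?r w) x = ap w (\<tau> n x)" for w x by (rule ap_reindex[OF bij])
      have "ap u' (\<tau> n x) + p * ap u (\<tau> n x)
          = ap (hop g I (?r u)) x + (W x - 2 * h * coord_sum I x) * ap u (\<tau> n x)" for x
      proof -
        have "ap u' (\<tau> n x) = ap (hop g I u) (\<tau> n x)
            + (W (\<tau> n x) - 2 * h * coord_sum I (\<tau> n x)) * ap u (\<tau> n x)"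
          using u by (simp add: ham_def)
        also have "W (\<tau> n x) = W x" using W[of x] by (simp add: \<tau>_def)
        finally show ?thesis by (simp add: hop tot p_def algebra_simps)
      qed
      moreover have "?r u \<in> supp_in (conf I)" "?r u' + p *\<^sub>R ?r u \<in> supp_in (conf I)"
        using u by (auto simp: ham_def supp_in_def r conf)
      ultimately have "(?r u, ?r u' + p *\<^sub>R ?r u) \<in> ham g h I W" by (simp add: ham_def r)
      from c(2)[OF this] have "c * norm u \<le> norm (?r u' + p *\<^sub>R ?r u - (t + p) *\<^sub>R ?r u)"
        by (simp add: norm_reindex[OF bij])
      also have "?r u' + p *\<^sub>R ?r u - (t + p) *\<^sub>R ?r u = ?r (u' - t *\<^sub>R u)"
        by (rule l2_eqI) (simp add: r algebra_simps)
      finally show "c * norm u \<le> norm (u' - t *\<^sub>R u)" by (simp add: norm_reindex[OF bij])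
    qed
  qed
  with t show ?thesis unfolding spec_def p_def by auto
qed

section \<open>Tensor products of functions of two clusters\<close>

definition restr :: "nat set \<Rightarrow> (nat \<Rightarrow> int) \<Rightarrow> nat \<Rightarrow> int" where
  "restr A x = (\<lambda>k. if k \<in> A then x k else 0)"

lemma restr_in_conf: "restr A x \<in> conf A" by (simp add: restr_def conf_def)

lemma restr_upd: "restr A (x(k := a)) = (if k \<in> A then (restr A x)(k := a) else restr A x)"
  by (auto simp: restr_def fun_eq_iff)

lemma restr_apply: "k \<in> A \<Longrightarrow> restr A x k = x k"
  by (simp add: restr_def)

lemma restr_eqD:
  assumes "x \<in> conf (A \<union> B)" "y \<in> conf (A \<union> B)" "restr A x = restr A y" "restr B x = restr B y"
  shows "x = y"
proof
  fix k
  show "x k = y k"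
    using assms(1,2) fun_cong[OF assms(3), of k] fun_cong[OF assms(4), of k]
    by (cases "k \<in> A"; cases "k \<in> B") (auto simp: conf_def restr_def)
qed

text \<open>A configuration in \<open>conf (A \<union> B)\<close> is determined by its two
  restrictions, so the sum is part of a product of two sums.\<close>

lemma sum_tensor_le:
  fixes e f :: "(nat \<Rightarrow> int) l2"
  assumes F: "finite F"
  shows "(\<Sum>x\<in>F. (if x \<in> conf (A \<union> B) then ap e (restr A x) * ap f (restr B x) else 0)\<^sup>2)
    \<le> (norm e * norm f)\<^sup>2"
proof -
  let ?G = "F \<inter> conf (A \<union> B)" and ?p = "\<lambda>x. (restr A x, restr B x)"
  have inj: "inj_on ?p ?G" by (rule inj_onI) (auto intro: restr_eqD)
  have "(\<Sum>x\<in>F. (if x \<in> conf (A \<union> B) then ap e (restr A x) * ap f (restr B x) else 0)\<^sup>2)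
      = (\<Sum>x\<in>?G. (ap e (restr A x))\<^sup>2 * (ap f (restr B x))\<^sup>2)"
    using F by (intro sum.mono_neutral_cong_right) (auto simp: power_mult_distrib)
  also have "\<dots> = (\<Sum>z\<in>?p ` ?G. (ap e (fst z))\<^sup>2 * (ap f (snd z))\<^sup>2)"
    by (simp add: sum.reindex[OF inj])
  also have "\<dots> \<le> (\<Sum>z\<in>restr A ` F \<times> restr B ` F. (ap e (fst z))\<^sup>2 * (ap f (snd z))\<^sup>2)"
    using F by (intro sum_mono2) auto
  also have "\<dots> = (\<Sum>a\<in>restr A ` F. (ap e a)\<^sup>2) * (\<Sum>b\<in>restr B ` F. (ap f b)\<^sup>2)"
    by (simp add: sum_product sum.cartesian_product case_prod_beta)
  also have "\<dots> \<le> (norm e)\<^sup>2 * (norm f)\<^sup>2"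
    using F by (intro mult_mono sum_sq_le_norm) (auto simp: sum_nonneg)
  finally show ?thesis by (simp add: power_mult_distrib)
qed

definition tensor :: "nat set \<Rightarrow> nat set \<Rightarrow> (nat \<Rightarrow> int) l2 \<Rightarrow> (nat \<Rightarrow> int) l2 \<Rightarrow> (nat \<Rightarrow> int) l2"
  where "tensor A B e f =
    Abs_l2 (\<lambda>x. if x \<in> conf (A \<union> B) then ap e (restr A x) * ap f (restr B x) else 0)"

lemma ap_tensor:
  "ap (tensor A B e f) x = (if x \<in> conf (A \<union> B) then ap e (restr A x) * ap f (restr B x) else 0)"
proof -
  have "(\<lambda>x. (if x \<in> conf (A \<union> B) then ap e (restr A x) * ap f (restr B x) else 0)\<^sup>2) summable_on UNIV"
    using sum_tensor_le[of _ A B e f]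
    by (intro nonneg_bdd_above_summable_on bdd_aboveI[of _ "(norm e * norm f)\<^sup>2"]) auto
  then have "ap (tensor A B e f) = (\<lambda>x. if x \<in> conf (A \<union> B) then ap e (restr A x) * ap f (restr B x) else 0)"
    unfolding tensor_def by (intro Abs_l2_inverse) simp
  then show ?thesis by simp
qed

lemma norm_tensor_le: "norm (tensor A B e f) \<le> norm e * norm f"
  by (rule norm_l2_le_if_sums) (simp_all add: ap_tensor sum_tensor_le)

lemma bounded_linear_tensor_left: "bounded_linear (\<lambda>e. tensor A B e f)"
  by (rule bounded_linear_intro[where K = "norm f"])
    (auto intro!: l2_eqI norm_tensor_le simp: ap_tensor algebra_simps)

lemma bounded_linear_tensor_right: "bounded_linear (tensor A B e)"
  by (rule bounded_linear_intro[where K = "norm e"])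
    (auto intro!: l2_eqI norm_tensor_le simp: ap_tensor algebra_simps norm_tensor_le[of _ _ e, unfolded mult.commute[of "norm e"]])

lemma tensor_delta:
  assumes "x \<in> conf (A \<union> B)"
  shows "tensor A B (delta (restr A x)) (delta (restr B x)) = delta x"
  by (rule l2_eqI) (use assms restr_eqD in \<open>auto simp: ap_tensor ap_delta\<close>)

text \<open>A hop changes only the restriction to the cluster of the hopping particle, so hopping,
  field and potential all split and the eigenvalues add.\<close>

lemma tensor_ham:
  assumes "(e, a *\<^sub>R e) \<in> ham g h A W1" "(f, b *\<^sub>R f) \<in> ham g h B W2"
    and disj: "A \<inter> B = {}" and fin: "finite A" "finite B"
    and W: "\<And>x. W x = W1 (restr A x) + W2 (restr B x)"
  shows "(tensor A B e f, (a + b) *\<^sub>R tensor A B e f) \<in> ham g h (A \<union> B) W"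
proof -
  let ?t = "tensor A B e f"
  have E: "a * ap e y = ap (hop g A e) y + (W1 y - 2 * h * coord_sum A y) * ap e y" for y
    using assms(1) by (simp add: ham_def)
  have F: "b * ap f y = ap (hop g B f) y + (W2 y - 2 * h * coord_sum B y) * ap f y" for y
    using assms(2) by (simp add: ham_def)
  have supp: "?t \<in> supp_in (conf (A \<union> B))" by (simp add: supp_in_def ap_tensor)
  have "(a + b) * ap ?t x = ap (hop g (A \<union> B) ?t) x + (W x - 2 * h * coord_sum (A \<union> B) x) * ap ?t x" for x
  proof (cases "x \<in> conf (A \<union> B)")
    case True
    let ?y = "restr A x" and ?z = "restr B x"
    have A: "ap ?t (x(k := x k + s)) = ap e (?y(k := ?y k + s)) * ap f ?z" if "k \<in> A" for k s
      using that disj True by (auto simp: ap_tensor conf_upd restr_upd restr_apply)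
    have B: "ap ?t (x(k := x k + s)) = ap e ?y * ap f (?z(k := ?z k + s))" if "k \<in> B" for k s
      using that disj True by (auto simp: ap_tensor conf_upd restr_upd restr_apply)
    have "ap (hop g (A \<union> B) ?t) x
        = (\<Sum>k\<in>A. - g * (ap ?t (x(k := x k + 1)) + ap ?t (x(k := x k + - 1))))
        + (\<Sum>k\<in>B. - g * (ap ?t (x(k := x k + 1)) + ap ?t (x(k := x k + - 1))))"
      unfolding ap_hop using fin disj by (simp add: sum.union_disjoint)
    also have "(\<Sum>k\<in>A. - g * (ap ?t (x(k := x k + 1)) + ap ?t (x(k := x k + - 1)))) = ap (hop g A e) ?y * ap f ?z"
      unfolding ap_hop sum_distrib_right by (intro sum.cong refl) (simp only: A, simp add: algebra_simps)
    also have "(\<Sum>k\<in>B. - g * (ap ?t (x(k := x k + 1)) + ap ?t (x(k := x k + - 1)))) = ap e ?y * ap (hop g B f) ?z"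
      unfolding ap_hop sum_distrib_left by (intro sum.cong refl) (simp only: B, simp add: algebra_simps)
    finally have hop: "ap (hop g (A \<union> B) ?t) x = ap (hop g A e) ?y * ap f ?z + ap e ?y * ap (hop g B f) ?z" .
    have tot: "coord_sum (A \<union> B) x = coord_sum A ?y + coord_sum B ?z"
      using fin disj by (simp add: coord_sum_def sum.union_disjoint restr_apply)
    have t: "ap ?t x = ap e ?y * ap f ?z" using True by (simp add: ap_tensor)
    have "(a + b) * ap ?t x = (a * ap e ?y) * ap f ?z + ap e ?y * (b * ap f ?z)"
      by (simp add: t algebra_simps)
    also have "\<dots> = ap (hop g (A \<union> B) ?t) x + (W x - 2 * h * coord_sum (A \<union> B) x) * ap ?t x"
      unfolding E F hop tot t W by (simp add: algebra_simps)
    finally show ?thesis .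
  next
    case False
    then show ?thesis using supp hop_supp_in[OF supp, of g] by (simp add: supp_in_def)
  qed
  moreover have "(a + b) *\<^sub>R ?t \<in> supp_in (conf (A \<union> B))"
    using supp subspace_supp_in subspace_scale by blast
  ultimately show ?thesis using supp by (simp add: ham_def)
qed

lemma bounded_linear_closure_span:
  assumes f: "bounded_linear f" and M: "subspace M" "closed M" and S: "f ` S \<subseteq> M"
    and x: "x \<in> closure (span S)"
  shows "f x \<in> M"
proof -
  interpret bounded_linear f by (fact f)
  have "subspace (f -` M)" by (rule linear_subspace_vimage[OF linear M(1)])
  then have "span S \<subseteq> f -` M" using S by (intro span_minimal) auto
  moreover have "closed (f -` M)" by (intro closed_vimage M continuous_on continuous_on_id)
  ultimately have "closure (span S) \<subseteq> f -` M" by (rule closure_minimal)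
  with x show ?thesis by blast
qed

text \<open>Continuity in each argument extends from \<open>E\<close> and \<open>F\<close> to
  arbitrary factors, one slot at a time. This reaches every \<open>delta x\<close>, which is itself
  a tensor product.\<close>

lemma tensor_total:
  assumes "supp_in (conf A) \<subseteq> closure (span E)" "supp_in (conf B) \<subseteq> closure (span F)"
  shows "supp_in (conf (A \<union> B)) \<subseteq> closure (span {tensor A B e f | e f. e \<in> E \<and> f \<in> F})"
proof -
  define T where "T = {tensor A B e f | e f. e \<in> E \<and> f \<in> F}"
  have M: "subspace (closure (span T))" "closed (closure (span T))"
    by (auto intro: closure_subspace subspace_span)
  have 1: "tensor A B u f \<in> closure (span T)" if "u \<in> closure (span E)" "f \<in> F" for u f
  proof (rule bounded_linear_closure_span[OF bounded_linear_tensor_left M _ that(1)])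
    have "tensor A B e f \<in> span T" if "e \<in> E" for e
      using that \<open>f \<in> F\<close> by (intro span_base) (auto simp: T_def)
    then show "(\<lambda>e. tensor A B e f) ` E \<subseteq> closure (span T)" using closure_subset by blast
  qed
  have 2: "tensor A B u w \<in> closure (span T)" if "u \<in> closure (span E)" "w \<in> closure (span F)" for u w
    by (rule bounded_linear_closure_span[OF bounded_linear_tensor_right M _ that(2)]) (use 1 that in auto)
  have "delta ` conf (A \<union> B) \<subseteq> closure (span T)"
  proof safe
    fix x assume x: "x \<in> conf (A \<union> B)"
    have "delta (restr C x) \<in> supp_in (conf C)" for C
      using restr_in_conf[of C x] by (auto simp: supp_in_def ap_delta)
    with assms have "delta (restr A x) \<in> closure (span E)" "delta (restr B x) \<in> closure (span F)" by auto
    from 2[OF this] show "delta x \<in> closure (span T)" by (simp add: tensor_delta[OF x])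
  qed
  then have "span (delta ` conf (A \<union> B)) \<subseteq> closure (span T)" using M(1) by (rule span_minimal)
  then have "closure (span (delta ` conf (A \<union> B))) \<subseteq> closure (span T)" using M(2) by (rule closure_minimal)
  with supp_in_subset_closure_deltas show ?thesis unfolding T_def by blast
qed

text \<open>A sum of closed sets is closed once one of them is compact. The common period achieves
  this: a multiple of \<open>p\<close> is moved from \<open>s\<close> to \<open>t\<close> so that
  the first summand has absolute value at most \<open>\<bar>p\<bar>\<close>.\<close>

lemma closed_periodic_sum:
  fixes S T :: "real set"
  assumes "closed S" "closed T" "p \<noteq> 0"
    and S: "\<And>s n. s \<in> S \<Longrightarrow> s + p * of_int n \<in> S" and T: "\<And>t n. t \<in> T \<Longrightarrow> t + p * of_int n \<in> T"
  shows "closed {s + t | s t. s \<in> S \<and> t \<in> T}"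
proof -
  define K where "K = S \<inter> {- \<bar>p\<bar>..\<bar>p\<bar>}"
  have "compact K" unfolding K_def using assms(1) by (intro closed_Int_compact) auto
  then have "closed (\<Union>x\<in>K. \<Union>y\<in>T. {x + y})" using assms(2) by (rule compact_closed_sums)
  also have "(\<Union>x\<in>K. \<Union>y\<in>T. {x + y}) = {s + t | s t. s \<in> S \<and> t \<in> T}"
  proof (intro equalityI subsetI)
    fix z assume "z \<in> {s + t | s t. s \<in> S \<and> t \<in> T}"
    then obtain s t where st: "s \<in> S" "t \<in> T" "z = s + t" by blast
    define n where "n = \<lfloor>s / p\<rfloor>"
    have "0 \<le> s / p - of_int n" "s / p - of_int n < 1" unfolding n_def by linarith+
    then have "\<bar>s / p - of_int n\<bar> \<le> 1" by linarith
    then have "\<bar>p\<bar> * \<bar>s / p - of_int n\<bar> \<le> \<bar>p\<bar>" by (simp add: mult_left_le)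
    then have "\<bar>s - p * of_int n\<bar> \<le> \<bar>p\<bar>" using assms(3) by (simp add: abs_mult[symmetric] algebra_simps)
    then have "s - p * of_int n \<in> K" using S[OF st(1), of "- n"] by (auto simp: K_def abs_le_iff)
    moreover have "t + p * of_int n \<in> T" by (rule T[OF st(2)])
    ultimately show "z \<in> (\<Union>x\<in>K. \<Union>y\<in>T. {x + y})" using st(3)
      by (intro UN_I[of "s - p * of_int n"] UN_I[of "t + p * of_int n"]) auto
  qed (auto simp: K_def)
  finally show ?thesis .
qed

text \<open>Each unordered pair occurs once, with the smaller label first; the order matters because
  \<open>v\<close> may fail to be even.\<close>

definition pair_pot :: "(int \<Rightarrow> real) \<Rightarrow> nat set \<Rightarrow> (nat \<Rightarrow> int) \<Rightarrow> real" where
  "pair_pot v I x = (\<Sum>i\<in>I. \<Sum>j\<in>I \<inter> {i<..}. v (x i - x j))"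

lemma pair_pot_restr: "I \<subseteq> A \<Longrightarrow> pair_pot v I (restr A x) = pair_pot v I x"
  unfolding pair_pot_def by (intro sum.cong refl) (auto simp: restr_apply subset_iff)

lemma pair_pot_translate: "pair_pot v I (\<lambda>k. if k \<in> I then x k + n else x k) = pair_pot v I x"
  unfolding pair_pot_def by (intro sum.cong refl) auto

lemma spec_two_clusters:
  assumes h: "h \<noteq> 0" and fin: "finite A" "finite B" and ne: "A \<noteq> {}" "B \<noteq> {}" and disj: "A \<inter> B = {}"
    and cA: "countable (spec (ham g h A (pair_pot v A)))"
    and cB: "countable (spec (ham g h B (pair_pot v B)))"
  shows "countable (spec (ham g h (A \<union> B) (\<lambda>x. pair_pot v A x + pair_pot v B x)))"
proof -
  let ?A = "ham g h A (pair_pot v A)" and ?B = "ham g h B (pair_pot v B)"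
  let ?AB = "ham g h (A \<union> B) (\<lambda>x. pair_pot v A x + pair_pot v B x)"
  interpret A: self_adjoint_graph "supp_in (conf A)" ?A by (rule self_adjoint_ham)
  interpret B: self_adjoint_graph "supp_in (conf B)" ?B by (rule self_adjoint_ham)
  define S where "S = {s + t | s t. s \<in> spec ?A \<and> t \<in> spec ?B}"
  \<comment> \<open>The cluster \<open>A\<close> is moved by \<open>card B * n\<close> sites and
    \<open>B\<close> by \<open>card A * n\<close> sites, which yields the same period for both
    spectra.\<close>
  have per: "s + (2 * h * real (card A) * real (card B)) * of_int n \<in> spec ?A" if "s \<in> spec ?A" for s n
    using spec_ham_translate[OF pair_pot_translate that fin(1), of "int (card B) * n"] by (simp add: algebra_simps)
  have per': "s + (2 * h * real (card A) * real (card B)) * of_int n \<in> spec ?B" if "s \<in> spec ?B" for s n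
    using spec_ham_translate[OF pair_pot_translate that fin(2), of "int (card A) * n"] by (simp add: algebra_simps)
  have "closed S" unfolding S_def
    by (rule closed_periodic_sum[OF closed_spec closed_spec _ per per']) (use h fin ne in auto)
  have "S = (\<lambda>(s, t). s + t) ` (spec ?A \<times> spec ?B)" by (auto simp: S_def)
  then have "countable S" using cA cB by simp
  have in_spec: "a \<in> spec \<Gamma>" if "(e, a *\<^sub>R e) \<in> \<Gamma>" "e \<noteq> 0" for e a and \<Gamma> :: "((nat \<Rightarrow> int) l2 \<times> (nat \<Rightarrow> int) l2) set"
    using that by (auto simp: spec_def elim!: regular_atE) (metis diff_self mult_le_0_iff norm_le_zero_iff norm_zero not_le)
  have "spec ?AB \<subseteq> S"
  proof
    fix t assume t: "t \<in> spec ?AB"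
    show "t \<in> S"
    proof (rule ccontr)
      assume "t \<notin> S"
      with \<open>closed S\<close> obtain d where d: "d > 0" "\<And>y. y \<in> S \<Longrightarrow> d \<le> \<bar>y - t\<bar>"
        using separate_point_closed[of S t] by (auto simp: dist_real_def abs_minus_commute)
      \<comment> \<open>Zero vectors are removed because they satisfy the eigenvalue equation with
        every scalar, so their scalars need not be spectral values and the sums need not lie in
        \<open>S\<close>.\<close>
      let ?E = "{tensor A B e f | e f. e \<in> eigenvecs ?A - {0} \<and> f \<in> eigenvecs ?B - {0}}"
      have "regular_at ?AB t"
      proof (rule regular_if_eigenvectors_total[where E = ?E and d = d])
        show "inner u' w = inner u w'" if "(u, u') \<in> ?AB" "(w, w') \<in> ?AB" for u u' w w'
          using ham_symm that .
        fix e assume "e \<in> ?E"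
        then obtain e1 f1 where ef: "e = tensor A B e1 f1" "e1 \<in> eigenvecs ?A" "e1 \<noteq> 0"
            "f1 \<in> eigenvecs ?B" "f1 \<noteq> 0" by blast
        then obtain a b where ab: "(e1, a *\<^sub>R e1) \<in> ?A" "(f1, b *\<^sub>R f1) \<in> ?B" by (auto simp: eigenvecs_def)
        have "(e, (a + b) *\<^sub>R e) \<in> ?AB"
          unfolding ef(1) by (rule tensor_ham[OF ab disj fin]) (simp add: pair_pot_restr)
        moreover have "a + b \<in> S" using in_spec[OF ab(1) ef(3)] in_spec[OF ab(2) ef(5)] by (auto simp: S_def)
        ultimately show "\<exists>\<mu>. (e, \<mu> *\<^sub>R e) \<in> ?AB \<and> d \<le> \<bar>\<mu> - t\<bar>" using d(2) by blast
      next
        have "supp_in (conf (A \<union> B)) \<subseteq> closure (span ?E)"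
          using A.eigenvectors_total[OF cA] B.eigenvectors_total[OF cB]
          by (intro tensor_total) simp_all
        then show "fst ` ?AB \<subseteq> closure (span ?E)" by (auto simp: ham_def)
      qed (rule d)
      with t show False by (simp add: spec_def)
    qed
  qed
  then show ?thesis using \<open>countable S\<close> by (rule countable_subset)
qed

section \<open>Localisation at infinity\<close>

lemma finitely_many_convergent_subsequences:
  fixes f :: "nat \<Rightarrow> 'b \<Rightarrow> real"
  assumes "finite F" "\<And>x. x \<in> F \<Longrightarrow> bounded (range (\<lambda>n. f n x))"
  shows "\<exists>r. strict_mono r \<and> (\<forall>x\<in>F. convergent (\<lambda>n. f (r n) x))"
  using assms
proof (induction F rule: finite_induct)
  case empty
  show ?case by (rule exI[of _ id]) (simp add: strict_mono_def)
next
  case (insert y F)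
  then obtain r where r: "strict_mono r" "\<And>x. x \<in> F \<Longrightarrow> convergent (\<lambda>n. f (r n) x)" by auto
  have "bounded (range (\<lambda>n. f n y))" using insert.prems by simp
  then have "bounded (range (\<lambda>n. f (r n) y))" by (rule bounded_subset) auto
  then obtain s l where s: "strict_mono s" "((\<lambda>n. f (r n) y) \<circ> s) \<longlonglongrightarrow> l"
    using bounded_imp_convergent_subsequence by blast
  have "convergent (\<lambda>n. f ((r \<circ> s) n) x)" if "x \<in> insert y F" for x
  proof (cases "x = y")
    case True
    then show ?thesis using s(2) by (auto simp: convergent_def o_def)
  next
    case False
    then have "convergent (\<lambda>n. f (r n) x)" using r(2) that by blast
    then show ?thesis using convergent_subseq_convergent[OF _ s(1)] by (fastforce simp: o_def)
  qed
  then show ?case using strict_mono_o[OF r(1) s(1)] by blast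
qed

lemma norm_delta: "norm (delta x) = 1"
  by (simp add: norm_eq_sqrt_inner inner_delta ap_delta)

lemma norm_mul_indicator_le:
  assumes "finite F" shows "norm (mul (indicator F) u) \<le> (\<Sum>x\<in>F. \<bar>ap u x\<bar>)"
proof -
  have b: "bounded (range (indicator F :: 'a \<Rightarrow> real))"
    by (rule boundedI[of _ 1]) (auto simp: indicator_def)
  have "mul (indicator F) u = (\<Sum>x\<in>F. ap u x *\<^sub>R delta x)"
  proof (rule l2_eqI)
    fix x
    have "(\<Sum>y\<in>F. ap u y * ap (delta y) x) = (\<Sum>y\<in>F. if x = y then ap u y else 0)"
      by (intro sum.cong) (auto simp: ap_delta)
    then show "ap (mul (indicator F) u) x = ap (\<Sum>x\<in>F. ap u x *\<^sub>R delta x) x"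
      using assms by (simp add: ap_mul[OF b] indicator_def)
  qed
  also have "norm \<dots> \<le> (\<Sum>x\<in>F. norm (ap u x *\<^sub>R delta x))" by (rule norm_sum)
  finally show ?thesis by (simp add: norm_delta)
qed

text \<open>Compactness enters only through the finitely many coordinates in \<open>F\<close>: along a
  subsequence they converge, and the estimate makes the approximate eigenvectors Cauchy.\<close>
lemma eigenvalue_from_fredholm_estimate:
  fixes \<Gamma> :: "('a l2 \<times> 'a l2) set"
  assumes "self_adjoint_graph L \<Gamma>" and F: "finite F" and K: "0 \<le> K" and c: "0 \<le> c"
    and est: "\<And>u u'. (u, u') \<in> \<Gamma> \<Longrightarrow>
      norm u \<le> K * norm (u' - t *\<^sub>R u) + c * norm (mul (indicator F) u)"
    and t: "t \<in> spec \<Gamma>"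
  shows "\<exists>u. u \<noteq> 0 \<and> (u, t *\<^sub>R u) \<in> \<Gamma>"
proof -
  interpret self_adjoint_graph L \<Gamma> by fact
  have "\<exists>u u'. (u, u') \<in> \<Gamma> \<and> norm u = 1 \<and> norm (u' - t *\<^sub>R u) < 1 / real (Suc n)" for n
  proof -
    have "\<not> regular_at \<Gamma> t" using t by (simp add: spec_def)
    then obtain u u' where u: "(u, u') \<in> \<Gamma>" "norm (u' - t *\<^sub>R u) < 1 / real (Suc n) * norm u"
      unfolding regular_at_def by (metis not_le of_nat_0_less_iff zero_less_Suc zero_less_divide_1_iff)
    then have u0: "norm u > 0" by (metis mult_zero_right norm_ge_zero not_le order_le_less)
    let ?a = "1 / norm u"
    have "norm (?a *\<^sub>R u' - t *\<^sub>R (?a *\<^sub>R u)) = ?a * norm (u' - t *\<^sub>R u)"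
      using u0 by (simp add: scaleR_left_commute[of t] scaleR_diff_right[symmetric] del: scaleR_scaleR)
    also have "\<dots> < 1 / real (Suc n)" using u(2) u0 by (simp add: divide_less_eq)
    finally show ?thesis using graph_scale[OF u(1), of ?a] u0 by (intro exI conjI) auto
  qed
  then obtain u u' where u: "\<And>n. (u n, u' n) \<in> \<Gamma>" "\<And>n. norm (u n) = 1"
    "\<And>n. norm (u' n - t *\<^sub>R u n) < 1 / real (Suc n)" by metis
  have "bounded (range (\<lambda>n. ap (u n) x))" for x
    using ap_le_norm[of "u _" x] u(2) by (intro boundedI[of _ 1]) auto
  then obtain r where r: "strict_mono r" "\<And>x. x \<in> F \<Longrightarrow> convergent (\<lambda>n. ap (u (r n)) x)"
    using finitely_many_convergent_subsequences[OF F, of "\<lambda>n. ap (u n)"] by auto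
  then obtain l where l: "\<And>x. x \<in> F \<Longrightarrow> (\<lambda>n. ap (u (r n)) x) \<longlonglongrightarrow> l x"
    unfolding convergent_def by metis
  define z where "z n = u' (r n) - t *\<^sub>R u (r n)" for n
  have "(\<lambda>n. u' n - t *\<^sub>R u n) \<longlonglongrightarrow> 0"
    by (rule Lim_null_comparison[OF _ LIMSEQ_inverse_real_of_nat])
      (use u(3) in \<open>auto simp: inverse_eq_divide intro!: always_eventually less_imp_le\<close>)
  then have z: "z \<longlonglongrightarrow> 0"
    using LIMSEQ_subseq_LIMSEQ[OF _ r(1), of "\<lambda>n. u' n - t *\<^sub>R u n" 0]
    by (simp add: z_def[abs_def] o_def)
  \<comment> \<open>Each coordinate is compared with its limit \<open>l x\<close>, so that the
    estimate for a difference splits into two errors of one index each, both tending to 0.\<close>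
  define a where "a n = K * norm (z n) + c * (\<Sum>x\<in>F. \<bar>ap (u (r n)) x - l x\<bar>)" for n
  have "a \<longlonglongrightarrow> K * norm (0 :: 'a l2) + c * (\<Sum>x\<in>F. \<bar>l x - l x\<bar>)"
    unfolding a_def
    by (intro tendsto_add tendsto_mult_left tendsto_norm tendsto_sum tendsto_rabs tendsto_diff
        tendsto_const z l)
  then have a: "a \<longlonglongrightarrow> 0" by simp
  have dist: "norm (u (r m) - u (r n)) \<le> a m + a n" for m n
  proof -
    have "u' (r m) - u' (r n) - t *\<^sub>R (u (r m) - u (r n)) = z m - z n"
      by (simp add: z_def algebra_simps)
    then have le: "norm (u (r m) - u (r n))
        \<le> K * norm (z m - z n) + c * norm (mul (indicator F) (u (r m) - u (r n)))"
      using est[OF graph_diff[OF u(1) u(1)], of "r m" "r n"] by simp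
    have "K * norm (z m - z n) \<le> K * (norm (z m) + norm (z n))"
      by (rule mult_left_mono[OF norm_triangle_ineq4 K])
    moreover have "norm (mul (indicator F) (u (r m) - u (r n)))
        \<le> (\<Sum>x\<in>F. \<bar>ap (u (r m)) x - l x\<bar> + \<bar>ap (u (r n)) x - l x\<bar>)"
      using norm_mul_indicator_le[OF F, of "u (r m) - u (r n)"]
      by (rule order_trans) (intro sum_mono, simp)
    then have "c * norm (mul (indicator F) (u (r m) - u (r n)))
        \<le> c * (\<Sum>x\<in>F. \<bar>ap (u (r m)) x - l x\<bar> + \<bar>ap (u (r n)) x - l x\<bar>)"
      by (rule mult_left_mono[OF _ c])
    ultimately show ?thesis using le unfolding a_def sum.distrib distrib_left by linarith
  qed
  have "Cauchy (\<lambda>n. u (r n))"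
  proof (rule metric_CauchyI)
    fix e :: real assume "e > 0"
    then obtain N where N: "\<And>n. n \<ge> N \<Longrightarrow> \<bar>a n\<bar> < e / 2"
      using LIMSEQ_D[OF a, of "e / 2"] by auto
    have "dist (u (r m)) (u (r n)) < e" if "m \<ge> N" "n \<ge> N" for m n
      using dist[of m n] N[OF that(1)] N[OF that(2)] unfolding dist_norm by linarith
    then show "\<exists>M. \<forall>m\<ge>M. \<forall>n\<ge>M. dist (u (r m)) (u (r n)) < e" by blast
  qed
  then obtain w where w: "(\<lambda>n. u (r n)) \<longlonglongrightarrow> w" using Cauchy_convergent convergent_def by blast
  have "(\<lambda>n. z n + t *\<^sub>R u (r n)) \<longlonglongrightarrow> 0 + t *\<^sub>R w" by (intro tendsto_intros z w)
  then have "(\<lambda>n. u' (r n)) \<longlonglongrightarrow> t *\<^sub>R w" by (simp add: z_def)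
  then have "(w, t *\<^sub>R w) \<in> \<Gamma>" by (rule graph_limit[OF u(1) w])
  moreover have "(\<lambda>n. norm (u (r n))) \<longlonglongrightarrow> norm w" by (intro tendsto_intros w)
  then have "norm w = 1" by (simp add: u(2) LIMSEQ_const_iff)
  ultimately show ?thesis by (intro exI[of _ w]) auto
qed

section \<open>Cutoffs to the region where two clusters are far apart\<close>

definition ramp :: "real \<Rightarrow> real \<Rightarrow> int \<Rightarrow> real" where
  "ramp l m n = max 0 (min 1 ((real_of_int \<bar>n\<bar> - l) / m))"

lemma ramp_bounds: "\<bar>ramp l m n\<bar> \<le> 1"
  by (simp add: ramp_def)

lemma ramp_nonzeroD: "0 < m \<Longrightarrow> ramp l m n \<noteq> 0 \<Longrightarrow> l < real_of_int \<bar>n\<bar>"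
  using divide_nonpos_pos[of "real_of_int \<bar>n\<bar> - l" m] by (force simp: ramp_def)

lemma ramp_eq_1: "0 < m \<Longrightarrow> l + m \<le> real_of_int \<bar>n\<bar> \<Longrightarrow> ramp l m n = 1"
  by (simp add: ramp_def le_divide_eq min_def)

lemma ramp_lipschitz:
  assumes "0 < m" "\<bar>n - n'\<bar> \<le> 1" shows "\<bar>ramp l m n - ramp l m n'\<bar> \<le> 1 / m"
proof -
  define a where "a = (real_of_int \<bar>n\<bar> - l) / m"
  define b where "b = (real_of_int \<bar>n'\<bar> - l) / m"
  have "\<bar>\<bar>n\<bar> - \<bar>n'\<bar>\<bar> \<le> 1" using assms(2) by linarith
  then have "\<bar>real_of_int \<bar>n\<bar> - real_of_int \<bar>n'\<bar>\<bar> \<le> 1" by linarith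
  then have "\<bar>real_of_int \<bar>n\<bar> - real_of_int \<bar>n'\<bar>\<bar> / m \<le> 1 / m" using assms(1) by (intro divide_right_mono) auto
  moreover have "a - b = (real_of_int \<bar>n\<bar> - real_of_int \<bar>n'\<bar>) / m"
    by (simp add: a_def b_def diff_divide_distrib)
  ultimately have "\<bar>a - b\<bar> \<le> 1 / m" using assms(1) by (simp add: abs_divide)
  moreover have "\<bar>max 0 (min 1 a) - max 0 (min 1 b)\<bar> \<le> \<bar>a - b\<bar>" by linarith
  ultimately show ?thesis by (simp add: ramp_def a_def b_def)
qed

text \<open>For positive \<open>m\<close>, a nonzero value forces every cross pair beyond distance
  \<open>l\<close>, and the value is 1 once all of them reach \<open>l + m\<close>. A large width
  \<open>m\<close> makes the slope, and with it the commutator with hopping, small.\<close>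

definition cutoff :: "real \<Rightarrow> real \<Rightarrow> nat set \<Rightarrow> nat set \<Rightarrow> (nat \<Rightarrow> int) \<Rightarrow> real" where
  "cutoff l m A B x = (\<Prod>p\<in>A \<times> B. ramp l m (x (fst p) - x (snd p)))"

lemma cutoff_bounds: "\<bar>cutoff l m A B x\<bar> \<le> 1"
  unfolding cutoff_def abs_prod by (intro prod_le_1) (simp add: ramp_bounds)

lemma cutoff_lipschitz:
  assumes "0 < m" "finite A" "finite B" "\<bar>s\<bar> \<le> 1"
  shows "\<bar>cutoff l m A B (x(k := x k + s)) - cutoff l m A B x\<bar> \<le> real (card A * card B) / m"
proof -
  let ?y = "x(k := x k + s)"
  have "\<bar>cutoff l m A B ?y - cutoff l m A B x\<bar>
      \<le> (\<Sum>p\<in>A \<times> B. \<bar>ramp l m (?y (fst p) - ?y (snd p)) - ramp l m (x (fst p) - x (snd p))\<bar>)"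
    unfolding cutoff_def real_norm_def[symmetric]
    by (intro norm_prod_diff) (simp_all add: ramp_bounds)
  also have "\<dots> \<le> (\<Sum>p\<in>A \<times> B. 1 / m)"
    using assms by (intro sum_mono ramp_lipschitz) auto
  finally show ?thesis by (simp add: card_cartesian_product)
qed

text \<open>Over the common index set of pairs of \<open>I\<close>, the potentials of both clusters
  can be subtracted from the full one term by term.\<close>

lemma pair_pot_subset:
  assumes "finite I" "C \<subseteq> I"
  shows "pair_pot v C x = (\<Sum>i\<in>I. \<Sum>j\<in>I \<inter> {i<..}. if i \<in> C \<and> j \<in> C then v (x i - x j) else 0)"
  unfolding pair_pot_def
proof (rule sum.mono_neutral_cong_left)
  fix i assume "i \<in> C"
  then show "(\<Sum>j\<in>C \<inter> {i<..}. v (x i - x j))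
      = (\<Sum>j\<in>I \<inter> {i<..}. if i \<in> C \<and> j \<in> C then v (x i - x j) else 0)"
    using assms by (intro sum.mono_neutral_cong_left) auto
qed (use assms in auto)

lemma abs_double_sum_le:
  fixes f :: "nat \<Rightarrow> nat \<Rightarrow> real"
  assumes "finite I" "\<And>i j. i \<in> I \<Longrightarrow> j \<in> I \<Longrightarrow> \<bar>f i j\<bar> \<le> b" "0 \<le> b"
  shows "\<bar>\<Sum>i\<in>I. \<Sum>j\<in>I \<inter> {i<..}. f i j\<bar> \<le> (real (card I))\<^sup>2 * b"
proof -
  have "\<bar>\<Sum>i\<in>I. \<Sum>j\<in>I \<inter> {i<..}. f i j\<bar> \<le> (\<Sum>i\<in>I. \<Sum>j\<in>I \<inter> {i<..}. \<bar>f i j\<bar>)"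
    by (rule order_trans[OF sum_abs]) (intro sum_mono sum_abs)
  also have "\<dots> \<le> (\<Sum>i\<in>I. \<Sum>j\<in>I. b)"
  proof (rule sum_mono)
    fix i assume i: "i \<in> I"
    have "(\<Sum>j\<in>I \<inter> {i<..}. \<bar>f i j\<bar>) \<le> (\<Sum>j\<in>I \<inter> {i<..}. b)" using assms(2) i by (intro sum_mono) auto
    also have "\<dots> \<le> (\<Sum>j\<in>I. b)" using assms by (intro sum_mono2) auto
    finally show "(\<Sum>j\<in>I \<inter> {i<..}. \<bar>f i j\<bar>) \<le> (\<Sum>j\<in>I. b)" .
  qed
  finally show ?thesis by (simp add: power2_eq_square)
qed

lemma pair_pot_bound:
  assumes "finite I" "\<And>n. \<bar>v n\<bar> \<le> b" shows "\<bar>pair_pot v I x\<bar> \<le> (real (card I))\<^sup>2 * b"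
proof -
  have "0 \<le> b" using assms(2)[of 0] by linarith
  then show ?thesis unfolding pair_pot_def using assms by (intro abs_double_sum_le) auto
qed

text \<open>Only pairs with one label in each cluster survive the subtraction. The smaller label may
  lie on either side, hence the bound on \<open>v\<close> for both signs of the argument.\<close>

lemma inter_cluster_pot_le:
  assumes "finite I" "C \<subseteq> I" "0 \<le> b" "\<And>i j. i \<in> C \<Longrightarrow> j \<in> I - C \<Longrightarrow> \<bar>v (x i - x j)\<bar> \<le> b \<and> \<bar>v (x j - x i)\<bar> \<le> b"
  shows "\<bar>pair_pot v I x - pair_pot v C x - pair_pot v (I - C) x\<bar> \<le> (real (card I))\<^sup>2 * b"
proof -
  have "pair_pot v I x - pair_pot v C x - pair_pot v (I - C) x
      = (\<Sum>i\<in>I. \<Sum>j\<in>I \<inter> {i<..}. if (i \<in> C) = (j \<in> C) then 0 else v (x i - x j))"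
    unfolding pair_pot_subset[OF assms(1,2)] pair_pot_subset[OF assms(1) Diff_subset]
    unfolding pair_pot_def sum_subtractf[symmetric] by (intro sum.cong refl) auto
  also have "\<bar>\<dots>\<bar> \<le> (real (card I))\<^sup>2 * b"
    using assms by (intro abs_double_sum_le) auto
  finally show ?thesis .
qed

text \<open>The commutator of a shift with multiplication by \<open>J\<close> is the same shift
  followed by multiplication by an increment of \<open>J\<close>, of size at most
  \<open>\<kappa>\<close>.\<close>

lemma norm_commutator_le:
  assumes m: "\<And>x. \<bar>J x\<bar> \<le> 1"
    and lip: "\<And>x k s. \<bar>s\<bar> \<le> 1 \<Longrightarrow> \<bar>J (x(k := x k + s)) - J x\<bar> \<le> \<kappa>"
  shows "norm (hop g I (mul J u) - mul J (hop g I u)) \<le> 2 * \<bar>g\<bar> * real (card I) * \<kappa> * norm u"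
proof -
  have b: "bounded (range J)" using m by (auto intro!: boundedI[of _ 1])
  have \<kappa>: "0 \<le> \<kappa>" using lip[of 0 "\<lambda>_. 0" 0] by simp
  define d where "d k s = shift k s (mul J u) - mul J (shift k s u)" for k s
  have d: "norm (d k s) \<le> \<kappa> * norm u" if "\<bar>s\<bar> \<le> 1" for k s
  proof -
    have "norm (d k s) \<le> \<kappa> * norm (shift k s u)"
    proof (rule norm_l2_le[OF _ \<kappa>])
      fix x
      have "ap (d k s) x = (J (x(k := x k + s)) - J x) * ap (shift k s u) x"
        by (simp add: d_def ap_shift ap_mul[OF b] algebra_simps)
      then show "\<bar>ap (d k s) x\<bar> \<le> \<kappa> * \<bar>ap (shift k s u) x\<bar>"
        using lip[OF that] by (simp add: abs_mult mult_right_mono)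
    qed
    then show ?thesis by (simp add: norm_shift)
  qed
  have "hop g I (mul J u) - mul J (hop g I u) = (\<Sum>k\<in>I. (- g) *\<^sub>R (d k 1 + d k (- 1)))"
    by (rule l2_eqI) (simp add: ap_hop ap_mul[OF b] d_def ap_shift sum_distrib_left sum_subtractf[symmetric] algebra_simps)
  also have "norm \<dots> \<le> (\<Sum>k\<in>I. norm ((- g) *\<^sub>R (d k 1 + d k (- 1))))" by (rule norm_sum)
  also have "\<dots> \<le> (\<Sum>k\<in>I. \<bar>g\<bar> * (2 * \<kappa> * norm u))"
  proof (rule sum_mono)
    fix k
    have "norm (d k 1 + d k (- 1)) \<le> 2 * \<kappa> * norm u"
      using norm_triangle_ineq[of "d k 1" "d k (- 1)"] d[of 1 k] d[of "- 1" k] by simp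
    then show "norm ((- g) *\<^sub>R (d k 1 + d k (- 1))) \<le> \<bar>g\<bar> * (2 * \<kappa> * norm u)"
      by (simp add: mult_left_mono)
  qed
  finally show ?thesis by (simp add: algebra_simps)
qed

text \<open>Where the clusters \<open>C\<close> and \<open>I - C\<close> are far apart, the interaction between them is small;
  a slowly varying cutoff to this region almost commutes with hopping.\<close>
lemma cluster_estimate:
  assumes I: "finite I" and C: "C \<subseteq> I" and \<delta>: "0 < \<delta>"
    and vb: "\<And>n. \<bar>v n\<bar> \<le> b" and decay: "\<And>\<epsilon>. 0 < \<epsilon> \<Longrightarrow> \<exists>l. \<forall>n. l \<le> real_of_int \<bar>n\<bar> \<longrightarrow> \<bar>v n\<bar> \<le> \<epsilon>"
    and low: "\<And>u u'. (u, u') \<in> ham g h I (\<lambda>x. pair_pot v C x + pair_pot v (I - C) x) \<Longrightarrow>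
      c * norm u \<le> norm (u' - t *\<^sub>R u)"
  shows "\<exists>D J. (\<forall>x. \<bar>J x\<bar> \<le> 1) \<and>
    (\<forall>x. (\<forall>i\<in>C. \<forall>j\<in>I - C. D \<le> \<bar>x i - x j\<bar>) \<longrightarrow> J x = 1) \<and>
    (\<forall>u u'. (u, u') \<in> ham g h I (pair_pot v I) \<longrightarrow>
      c * norm (mul J u) \<le> norm (u' - t *\<^sub>R u) + \<delta> * norm u)"
proof -
  \<comment> \<open>Bounds the number of pairs, and stays positive for empty \<open>I\<close>; half
    of \<open>\<delta>\<close> is then shared among the pairs through
    \<open>\<epsilon>\<close>.\<close>
  define N where "N = (real (card I))\<^sup>2 + 1"
  have N: "N > 0" by (simp add: N_def add_nonneg_pos)
  define \<epsilon> where "\<epsilon> = \<delta> / (2 * N)"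
  have \<epsilon>: "\<epsilon> > 0" using \<delta> N by (simp add: \<epsilon>_def)
  obtain l where l: "\<And>n. l \<le> real_of_int \<bar>n\<bar> \<Longrightarrow> \<bar>v n\<bar> \<le> \<epsilon>" using decay[OF \<epsilon>] by blast
  define q where "q = 2 * \<bar>g\<bar> * real (card I) * real (card C * card (I - C))"
  \<comment> \<open>The commutator will be bounded by \<open>q / m\<close>, which this choice makes
    at most \<open>\<delta> / 2\<close>; the summand 1 covers \<open>q = 0\<close>.\<close>
  define m where "m = 2 * q / \<delta> + 1"
  have q: "q \<ge> 0" by (simp add: q_def)
  have m: "m > 0" using q \<delta> by (simp add: m_def add_nonneg_pos)
  have qm: "q / m \<le> \<delta> / 2" using m \<delta> q by (simp add: m_def field_simps)
  define J where "J = cutoff l m C (I - C)"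
  have finC: "finite C" "finite (I - C)" using I C finite_subset by auto
  have J1: "\<bar>J x\<bar> \<le> 1" for x by (simp add: J_def cutoff_bounds)
  have bJ: "bounded (range J)" using J1 by (auto intro!: boundedI[of _ 1])
  define X where "X x = pair_pot v I x - pair_pot v C x - pair_pot v (I - C) x" for x
  \<comment> \<open>The interaction \<open>X\<close> between the clusters need not be small
    everywhere, but where \<open>J\<close> does not vanish all cross pairs are farther than
    \<open>l\<close> apart.\<close>
  have JX: "\<bar>J x * X x\<bar> \<le> \<delta> / 2" for x
  proof (cases "J x = 0")
    case False
    have far: "l < real_of_int \<bar>x i - x j\<bar>" if "i \<in> C" "j \<in> I - C" for i j
    proof (rule ramp_nonzeroD[OF m])
      show "ramp l m (x i - x j) \<noteq> 0"
        using False that finC by (auto simp: J_def cutoff_def)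
    qed
    have "\<bar>X x\<bar> \<le> (real (card I))\<^sup>2 * \<epsilon>"
      unfolding X_def
    proof (rule inter_cluster_pot_le[OF I C])
      show "\<bar>v (x i - x j)\<bar> \<le> \<epsilon> \<and> \<bar>v (x j - x i)\<bar> \<le> \<epsilon>" if "i \<in> C" "j \<in> I - C" for i j
        using far[OF that] by (auto intro!: l simp: abs_minus_commute)
    qed (use \<epsilon> in simp)
    also have "\<dots> \<le> N * \<epsilon>" using \<epsilon> by (simp add: N_def)
    also have "\<dots> = \<delta> / 2" using N by (simp add: \<epsilon>_def)
    finally have "\<bar>X x\<bar> \<le> \<delta> / 2" .
    then have "\<bar>J x\<bar> * \<bar>X x\<bar> \<le> 1 * (\<delta> / 2)" using J1 by (intro mult_mono) auto
    then show ?thesis by (simp add: abs_mult)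
  qed (use \<delta> in auto)
  have bX: "bounded (range (\<lambda>x. J x * X x))" using JX by (auto intro!: boundedI[of _ "\<delta> / 2"])
  have est: "c * norm (mul J u) \<le> norm (u' - t *\<^sub>R u) + \<delta> * norm u"
    if u: "(u, u') \<in> ham g h I (pair_pot v I)" for u u'
  proof -
    define w where "w = hop g I (mul J u) - mul J (hop g I u)"
    define k where "k = mul (\<lambda>x. J x * X x) u"
    \<comment> \<open>Applying \<open>J\<close> to the equation for \<open>u\<close> gives the
      decoupled equation for \<open>J u\<close> up to the commutator \<open>w\<close> and the
      cut-off interaction \<open>k\<close>. Both corrections are square-summable, so
      \<open>J u\<close> is in the decoupled domain.\<close>
    have "(mul J u, mul J u' + w - k) \<in> ham g h I (\<lambda>x. pair_pot v C x + pair_pot v (I - C) x)"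
    proof -
      have us: "u \<in> supp_in (conf I)" "u' \<in> supp_in (conf I)" using u by (auto simp: ham_def)
      have "mul J u \<in> supp_in (conf I)" using us(1) by (simp add: supp_in_def ap_mul[OF bJ])
      moreover have "mul J u' + w - k \<in> supp_in (conf I)"
        using us hop_supp_in[OF us(1), of g] hop_supp_in[OF \<open>mul J u \<in> supp_in (conf I)\<close>, of g]
        by (simp add: supp_in_def w_def k_def ap_mul[OF bJ] ap_mul[OF bX])
      moreover have "ap (mul J u' + w - k) x = ap (hop g I (mul J u)) x
          + (pair_pot v C x + pair_pot v (I - C) x - 2 * h * coord_sum I x) * ap (mul J u) x" for x
      proof -
        have u': "ap u' x = ap (hop g I u) x + (pair_pot v I x - 2 * h * coord_sum I x) * ap u x"
          using u by (simp add: ham_def)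
        have k: "ap k x = J x * X x * ap u x" by (simp add: k_def ap_mul[OF bX])
        show ?thesis by (simp add: w_def ap_mul[OF bJ] u' k X_def algebra_simps)
      qed
      ultimately show ?thesis by (simp add: ham_def)
    qed
    from low[OF this] have "c * norm (mul J u) \<le> norm (mul J u' + w - k - t *\<^sub>R mul J u)" .
    also have "mul J u' + w - k - t *\<^sub>R mul J u = mul J (u' - t *\<^sub>R u) + (w - k)"
      by (rule l2_eqI) (simp add: ap_mul[OF bJ] algebra_simps)
    also have "norm \<dots> \<le> norm (mul J (u' - t *\<^sub>R u)) + (norm w + norm k)"
      by (rule order_trans[OF norm_triangle_ineq]) (intro add_left_mono norm_triangle_ineq4)
    also have "norm (mul J (u' - t *\<^sub>R u)) \<le> norm (u' - t *\<^sub>R u)"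
      using norm_mul_le[OF J1] by simp
    also have "norm w \<le> \<delta> / 2 * norm u"
    proof -
      have "norm w \<le> 2 * \<bar>g\<bar> * real (card I) * (real (card C * card (I - C)) / m) * norm u"
        unfolding w_def by (intro norm_commutator_le J1) (use cutoff_lipschitz[OF m finC] in \<open>simp add: J_def\<close>)
      also have "\<dots> = q / m * norm u" by (simp add: q_def)
      also have "\<dots> \<le> \<delta> / 2 * norm u" using qm by (intro mult_right_mono) auto
      finally show ?thesis .
    qed
    also have "norm k \<le> \<delta> / 2 * norm u" unfolding k_def by (rule norm_mul_le[OF JX])
    finally show ?thesis by (simp add: field_simps)
  qed
  have "J x = 1" if "\<forall>i\<in>C. \<forall>j\<in>I - C. \<lceil>l + m\<rceil> \<le> \<bar>x i - x j\<bar>" for x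
  proof -
    have "ramp l m (x i - x j) = 1" if "i \<in> C" "j \<in> I - C" for i j
      using \<open>\<forall>i\<in>C. \<forall>j\<in>I - C. \<lceil>l + m\<rceil> \<le> \<bar>x i - x j\<bar>\<close> that
      by (intro ramp_eq_1 m) (auto simp: ceiling_le_iff)
    then show ?thesis unfolding J_def cutoff_def by (intro prod.neutral) auto
  qed
  with J1 est show ?thesis by blast
qed

text \<open>The equation is solved for its field term, which is a combination of bounded operators
  applied to \<open>u\<close> and the residual \<open>u' - t *\<^sub>R u\<close>. On the region in
  question the field factor exceeds \<open>2 * \<bar>h\<bar> * R\<close> in absolute value.\<close>

lemma large_coord_sum_estimate:
  assumes u: "(u, u') \<in> ham g h I W" and W: "\<And>x. \<bar>W x\<bar> \<le> b" and h: "h \<noteq> 0" and R: "R > 0"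
  shows "norm (mul (indicator {x. R < \<bar>coord_sum I x\<bar>}) u)
    \<le> (norm (u' - t *\<^sub>R u) + (2 * \<bar>g\<bar> * real (card I) + b + \<bar>t\<bar>) * norm u) / (2 * \<bar>h\<bar> * R)"
proof -
  have b: "bounded (range (indicator {x. R < \<bar>coord_sum I x\<bar>} :: _ \<Rightarrow> real))"
    by (rule boundedI[of _ 1]) (auto simp: indicator_def)
  have bW: "bounded (range W)" using W by (auto intro!: boundedI[of _ b])
  define z where "z = hop g I u + mul W u - t *\<^sub>R u - (u' - t *\<^sub>R u)"
  have hR: "2 * \<bar>h\<bar> * R > 0" using h R by simp
  have main: "norm (mul (indicator {x. R < \<bar>coord_sum I x\<bar>}) u) \<le> 1 / (2 * \<bar>h\<bar> * R) * norm z"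
  proof (rule norm_l2_le)
    fix x
    have z: "ap z x = 2 * h * coord_sum I x * ap u x"
      using u by (simp add: z_def ham_def ap_mul[OF bW] algebra_simps)
    show "\<bar>ap (mul (indicator {x. R < \<bar>coord_sum I x\<bar>}) u) x\<bar> \<le> 1 / (2 * \<bar>h\<bar> * R) * \<bar>ap z x\<bar>"
    proof (cases "R < \<bar>coord_sum I x\<bar>")
      case True
      then have "2 * \<bar>h\<bar> * R * \<bar>ap u x\<bar> \<le> 2 * \<bar>h\<bar> * \<bar>coord_sum I x\<bar> * \<bar>ap u x\<bar>"
        by (intro mult_right_mono mult_left_mono) auto
      then have "\<bar>ap u x\<bar> \<le> \<bar>ap z x\<bar> / (2 * \<bar>h\<bar> * R)"
        unfolding pos_le_divide_eq[OF hR] z abs_mult by (simp add: mult_ac)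
      then show ?thesis using True by (simp add: ap_mul[OF b])
    qed (use hR in \<open>simp add: ap_mul[OF b]\<close>)
  qed (use hR in simp)
  have "norm z \<le> norm (hop g I u) + norm (mul W u) + norm (t *\<^sub>R u) + norm (u' - t *\<^sub>R u)"
    unfolding z_def
    using norm_triangle_ineq4[of "hop g I u + mul W u - t *\<^sub>R u" "u' - t *\<^sub>R u"]
      norm_triangle_ineq4[of "hop g I u + mul W u" "t *\<^sub>R u"]
      norm_triangle_ineq[of "hop g I u" "mul W u"] by linarith
  also have "\<dots> \<le> 2 * \<bar>g\<bar> * real (card I) * norm u + b * norm u + \<bar>t\<bar> * norm u + norm (u' - t *\<^sub>R u)"
    using norm_hop_le[of g I u] norm_mul_le[of W b u] W by simp
  finally have "norm z \<le> norm (u' - t *\<^sub>R u) + (2 * \<bar>g\<bar> * real (card I) + b + \<bar>t\<bar>) * norm u"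
    by (simp add: algebra_simps)
  then have "norm z / (2 * \<bar>h\<bar> * R)
      \<le> (norm (u' - t *\<^sub>R u) + (2 * \<bar>g\<bar> * real (card I) + b + \<bar>t\<bar>) * norm u) / (2 * \<bar>h\<bar> * R)"
    by (rule divide_right_mono) (use hR in simp)
  with main show ?thesis by simp
qed

text \<open>By \<open>conn\<close> no cut of \<open>I\<close> leaves all cross distances above
  \<open>D\<close>, so the neighbourhoods \<open>A n\<close> of \<open>i\<close> keep growing until
  they exhaust \<open>I\<close>.\<close>

lemma diameter_bound:
  fixes x :: "nat \<Rightarrow> int"
  assumes I: "finite I" and D: "0 \<le> D"
    and conn: "\<And>C. C \<noteq> {} \<Longrightarrow> C \<subset> I \<Longrightarrow> \<exists>i\<in>C. \<exists>j\<in>I - C. \<bar>x i - x j\<bar> \<le> D"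
    and ij: "i \<in> I" "j \<in> I"
  shows "\<bar>x i - x j\<bar> \<le> int (card I) * D"
proof -
  define A where "A n = {j\<in>I. \<bar>x i - x j\<bar> \<le> int n * D}" for n
  have finA: "finite (A n)" for n using I by (simp add: A_def)
  \<comment> \<open>At least one particle is gained per step; the strict inequality makes the second
    alternative impossible at \<open>n = card I\<close>.\<close>
  have "A n = I \<or> n < card (A n)" for n
  proof (induction n)
    case 0
    have "i \<in> A 0" using ij by (simp add: A_def)
    then have "0 < card (A 0)" using finA[of 0] by (auto simp: card_gt_0_iff)
    then show ?case ..
  next
    case (Suc n)
    have mono: "A n \<subseteq> A (Suc n)" using D by (auto simp: A_def algebra_simps)
    have sub: "A m \<subseteq> I" for m by (auto simp: A_def)
    show ?case
    proof (cases "A n = I")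
      case True
      then have "A (Suc n) = I" using mono sub[of "Suc n"] by simp
      then show ?thesis ..
    next
      case False
      have "i \<in> A n" using ij D by (simp add: A_def)
      then have "A n \<noteq> {}" by blast
      moreover have "A n \<subset> I" using False sub[of n] by (simp add: psubset_eq)
      ultimately obtain a c where ac: "a \<in> A n" "c \<in> I - A n" "\<bar>x a - x c\<bar> \<le> D"
        using conn by metis
      then have "\<bar>x i - x a\<bar> \<le> int n * D" by (simp add: A_def)
      with ac(3) have "\<bar>x i - x c\<bar> \<le> int (Suc n) * D" by (simp add: algebra_simps)
      then have "c \<in> A (Suc n)" using ac(2) by (simp add: A_def)
      then have "card (A n) < card (A (Suc n))"
        using mono ac(2) by (intro psubset_card_mono finA) auto
      moreover have "n < card (A n)" using Suc False by simp
      ultimately show ?thesis by simp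
    qed
  qed
  moreover have "\<not> card I < card (A (card I))"
    using card_mono[OF I, of "A (card I)"] by (auto simp: A_def not_less)
  ultimately have "A (card I) = I" by blast
  then show ?thesis using ij by (auto simp: A_def)
qed

text \<open>Bounded differences leave only a common translation free, and the bound on the
  coordinate sum restricts it to finitely many values.\<close>

lemma finite_bounded_configurations:
  assumes I: "finite I" and D: "0 \<le> D"
  shows "finite {x \<in> conf I. \<bar>coord_sum I x\<bar> \<le> real_of_int R \<and>
    (\<forall>C. C \<noteq> {} \<longrightarrow> C \<subset> I \<longrightarrow> (\<exists>i\<in>C. \<exists>j\<in>I - C. \<bar>x i - x j\<bar> \<le> D))}" (is "finite ?S")
proof -
  let ?B = "{- (R + int (card I) * D)..R + int (card I) * D}"
  have "?S \<subseteq> {x. \<forall>i. (i \<in> I \<longrightarrow> x i \<in> ?B) \<and> (i \<notin> I \<longrightarrow> x i = 0)}"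
  proof (intro subsetI CollectI allI conjI impI)
    fix x i assume x: "x \<in> ?S"
    show "x i = 0" if "i \<notin> I" using x that by (simp add: conf_def)
    assume i: "i \<in> I"
    let ?n = "int (card I)"
    have n: "1 \<le> ?n" using i I by (metis One_nat_def Suc_leI card_gt_0_iff empty_iff of_nat_1 of_nat_le_iff)
    have diam: "\<bar>x i - x j\<bar> \<le> ?n * D" if "j \<in> I" for j
      using x by (intro diameter_bound I D i that) blast+
    have "\<bar>coord_sum I x\<bar> \<le> real_of_int R" using x by simp
    then have S: "\<bar>\<Sum>j\<in>I. x j\<bar> \<le> R" unfolding coord_sum_def by linarith
    have "?n * x i = (\<Sum>j\<in>I. x j) + (\<Sum>j\<in>I. x i - x j)" by (simp add: sum_subtractf)
    also have "\<bar>\<dots>\<bar> \<le> R + (\<Sum>j\<in>I. ?n * D)"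
    proof -
      have "\<bar>\<Sum>j\<in>I. x i - x j\<bar> \<le> (\<Sum>j\<in>I. \<bar>x i - x j\<bar>)" by (rule sum_abs)
      also have "\<dots> \<le> (\<Sum>j\<in>I. ?n * D)" by (intro sum_mono diam)
      finally show ?thesis using S by linarith
    qed
    finally have "?n * \<bar>x i\<bar> \<le> R + ?n * (?n * D)" using n by (simp add: abs_mult)
    also have "R \<le> ?n * R" using n S by (simp add: mult_le_cancel_right1)
    finally have "?n * \<bar>x i\<bar> \<le> ?n * (R + ?n * D)" by (simp add: algebra_simps)
    then have "\<bar>x i\<bar> \<le> R + ?n * D" using n by simp
    then show "x i \<in> ?B" by (auto simp: abs_le_iff)
  qed
  moreover have "finite {x. \<forall>i. (i \<in> I \<longrightarrow> x i \<in> ?B) \<and> (i \<notin> I \<longrightarrow> x i = (0 :: int))}"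
    using I by (intro finite_set_of_finite_funs) auto
  ultimately show ?thesis by (rule finite_subset)
qed

section \<open>Countability of the spectrum\<close>

text \<open>Large coordinate sums, separated clusters and a finite rest cover all configurations.
  The first two cost at most half of \<open>norm u\<close> in total; absorbing that half into the
  left side produces the factor 2.\<close>

lemma fredholm_estimate:
  assumes h: "h \<noteq> 0" and I: "finite I"
    and vb: "\<And>n. \<bar>v n\<bar> \<le> b" and decay: "\<And>\<epsilon>. 0 < \<epsilon> \<Longrightarrow> \<exists>l. \<forall>n. l \<le> real_of_int \<bar>n\<bar> \<longrightarrow> \<bar>v n\<bar> \<le> \<epsilon>"
    and reg: "\<And>C. C \<noteq> {} \<Longrightarrow> C \<subset> I \<Longrightarrow>
      regular_at (ham g h I (\<lambda>x. pair_pot v C x + pair_pot v (I - C) x)) t"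
  shows "\<exists>K F. 0 \<le> K \<and> finite F \<and> (\<forall>u u'. (u, u') \<in> ham g h I (pair_pot v I) \<longrightarrow>
    norm u \<le> K * norm (u' - t *\<^sub>R u) + 2 * norm (mul (indicator F) u))"
proof -
  define \<C> where "\<C> = {C. C \<noteq> {} \<and> C \<subset> I}"
  have fin: "finite \<C>" unfolding \<C>_def by (rule finite_subset[of _ "Pow I"]) (use I in auto)
  have "\<forall>C\<in>\<C>. \<exists>c>0. \<forall>u u'. (u, u') \<in> ham g h I (\<lambda>x. pair_pot v C x + pair_pot v (I - C) x) \<longrightarrow>
      c * norm u \<le> norm (u' - t *\<^sub>R u)"
    using reg unfolding \<C>_def regular_at_def by simp
  then obtain c where c: "\<And>C. C \<in> \<C> \<Longrightarrow> 0 < c C" "\<And>C u u'. C \<in> \<C> \<Longrightarrow>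
      (u, u') \<in> ham g h I (\<lambda>x. pair_pot v C x + pair_pot v (I - C) x) \<Longrightarrow>
      c C * norm u \<le> norm (u' - t *\<^sub>R u)"
    by metis
  \<comment> \<open>With tolerance \<open>c C / (4 * N)\<close>, division by \<open>c C\<close>
    leaves \<open>norm u / (4 * N)\<close> per cluster, hence at most a quarter of
    \<open>norm u\<close> over all of \<open>\<C>\<close>.\<close>
  define N where "N = real (card \<C>) + 1"
  have N: "N > 0" by (simp add: N_def)
  define good where "good C D J \<longleftrightarrow> (\<forall>x. \<bar>J x\<bar> \<le> 1) \<and>
    (\<forall>x. (\<forall>i\<in>C. \<forall>j\<in>I - C. D \<le> \<bar>x i - x j\<bar>) \<longrightarrow> J x = 1) \<and>
    (\<forall>u u'. (u, u') \<in> ham g h I (pair_pot v I) \<longrightarrow>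
      c C * norm (mul J u) \<le> norm (u' - t *\<^sub>R u) + (c C / (4 * N)) * norm u)" for C D J
  have "\<exists>D J. good C D J" if C: "C \<in> \<C>" for C
    unfolding good_def
    by (rule cluster_estimate[OF I _ _ vb decay c(2)[OF C]])
      (use C c(1)[OF C] N in \<open>auto simp: \<C>_def\<close>)
  then obtain D J where good: "\<And>C. C \<in> \<C> \<Longrightarrow> good C (D C) (J C)" by metis
  have J: "\<And>C x. C \<in> \<C> \<Longrightarrow> \<bar>J C x\<bar> \<le> 1"
      "\<And>C x. C \<in> \<C> \<Longrightarrow> (\<forall>i\<in>C. \<forall>j\<in>I - C. D C \<le> \<bar>x i - x j\<bar>) \<Longrightarrow> J C x = 1"
      "\<And>C u u'. C \<in> \<C> \<Longrightarrow> (u, u') \<in> ham g h I (pair_pot v I) \<Longrightarrow>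
        c C * norm (mul (J C) u) \<le> norm (u' - t *\<^sub>R u) + (c C / (4 * N)) * norm u"
    using good unfolding good_def by simp_all
  \<comment> \<open>One separation distance that serves all clusters at once.\<close>
  define D0 where "D0 = (\<Sum>C\<in>\<C>. \<bar>D C\<bar>)"
  have D0: "0 \<le> D0" by (simp add: D0_def sum_nonneg)
  have DC: "D C \<le> D0" if "C \<in> \<C>" for C
    using member_le_sum[OF that _ fin, of "\<lambda>C. \<bar>D C\<bar>"] by (simp add: D0_def)
  define B where "B = 2 * \<bar>g\<bar> * real (card I) + (real (card I))\<^sup>2 * b + \<bar>t\<bar>"
  have b: "0 \<le> b" using vb[of 0] by linarith
  have B: "0 \<le> B" unfolding B_def using b by simp
  \<comment> \<open>Large enough for the \<open>B\<close> term of
    \<open>large_coord_sum_estimate\<close> to be at most a quarter of \<open>norm u\<close>; the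
    summand 1 ensures positivity when \<open>B = 0\<close>.\<close>
  define R where "R = \<lceil>2 * B / \<bar>h\<bar>\<rceil> + 1"
  have RB: "2 * B / \<bar>h\<bar> \<le> real_of_int R" unfolding R_def by linarith
  have "0 \<le> 2 * B / \<bar>h\<bar>" using B by simp
  then have R: "0 < real_of_int R" unfolding R_def by linarith
  have hR: "0 < 2 * \<bar>h\<bar> * real_of_int R" using h R by simp
  have BR: "B / (2 * \<bar>h\<bar> * real_of_int R) \<le> 1 / 4"
    using RB h hR by (simp add: field_simps)
  define F where "F = {x \<in> conf I. \<bar>coord_sum I x\<bar> \<le> real_of_int R \<and>
    (\<forall>C. C \<noteq> {} \<longrightarrow> C \<subset> I \<longrightarrow> (\<exists>i\<in>C. \<exists>j\<in>I - C. \<bar>x i - x j\<bar> \<le> D0))}"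
  have F: "finite F" unfolding F_def by (rule finite_bounded_configurations[OF I D0])
  define K where "K = (\<Sum>C\<in>\<C>. 1 / c C) + 1 / (2 * \<bar>h\<bar> * real_of_int R)"
  have K: "0 \<le> K" unfolding K_def using c(1) hR by (intro add_nonneg_nonneg sum_nonneg) (auto intro: less_imp_le)
  have bind: "bounded (range (indicator A :: (nat \<Rightarrow> int) \<Rightarrow> real))" for A
    by (rule boundedI[of _ 1]) (auto simp: indicator_def)
  have bJ: "bounded (range (J C))" if "C \<in> \<C>" for C
    using J(1)[OF that] by (auto intro!: boundedI[of _ 1])
  have est: "norm u \<le> 2 * K * norm (u' - t *\<^sub>R u) + 2 * norm (mul (indicator F) u)"
    if u: "(u, u') \<in> ham g h I (pair_pot v I)" for u u'
  proof -
    let ?z = "norm (u' - t *\<^sub>R u)"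
    let ?S = "{x. real_of_int R < \<bar>coord_sum I x\<bar>}"
    \<comment> \<open>The left summand indexes the clusters; on the right, \<open>True\<close>
      stands for large coordinate sums and \<open>False\<close> for the finite set
      \<open>F\<close>.\<close>
    define f where "f = case_sum (\<lambda>C. mul (J C) u)
      (\<lambda>large. if large then mul (indicator ?S) u else mul (indicator F) u)"
    have "norm u \<le> (\<Sum>i\<in>\<C> <+> (UNIV :: bool set). norm (f i))"
    proof (rule norm_l2_le_cover)
      fix x
      consider "x \<notin> conf I" | "real_of_int R < \<bar>coord_sum I x\<bar>" | "x \<in> F"
        | C where "C \<in> \<C>" "\<forall>i\<in>C. \<forall>j\<in>I - C. D0 < \<bar>x i - x j\<bar>"
      proof (cases "x \<in> conf I \<and> \<bar>coord_sum I x\<bar> \<le> real_of_int R \<and> x \<notin> F")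
        case True
        then obtain C where "C \<noteq> {}" "C \<subset> I" "\<not> (\<exists>i\<in>C. \<exists>j\<in>I - C. \<bar>x i - x j\<bar> \<le> D0)"
          unfolding F_def by blast
        then show ?thesis using that(4)[of C] by (simp add: \<C>_def not_le)
      next
        case False
        then show ?thesis using that(1-3) by linarith
      qed
      then show "\<exists>i\<in>\<C> <+> (UNIV :: bool set). \<bar>ap u x\<bar> \<le> \<bar>ap (f i) x\<bar>"
      proof cases
        case 1
        then have "ap u x = 0" using u by (auto simp: ham_def supp_in_def)
        then show ?thesis by (intro bexI[of _ "Inr True"]) auto
      next
        case 2
        then show ?thesis by (intro bexI[of _ "Inr True"]) (auto simp: f_def ap_mul[OF bind])
      next
        case 3
        then show ?thesis by (intro bexI[of _ "Inr False"]) (auto simp: f_def ap_mul[OF bind])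
      next
        case 4
        have "J C x = 1"
          using 4(2) DC[OF 4(1)] by (intro J(2)[OF 4(1)]) (meson less_imp_le order_trans)
        then show ?thesis using 4(1)
          by (intro bexI[of _ "Inl C"]) (auto simp: f_def ap_mul[OF bJ[OF 4(1)]])
      qed
    qed (use fin in auto)
    also have "\<dots> = (\<Sum>C\<in>\<C>. norm (mul (J C) u)) + (norm (mul (indicator F) u) + norm (mul (indicator ?S) u))"
      using fin by (simp add: sum.Plus f_def UNIV_bool)
    finally have cover: "norm u \<le> (\<Sum>C\<in>\<C>. norm (mul (J C) u)) + (norm (mul (indicator F) u) + norm (mul (indicator ?S) u))" .
    have "(\<Sum>C\<in>\<C>. norm (mul (J C) u)) \<le> (\<Sum>C\<in>\<C>. 1 / c C * ?z + 1 / (4 * N) * norm u)"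
    proof (rule sum_mono)
      fix C assume C: "C \<in> \<C>"
      show "norm (mul (J C) u) \<le> 1 / c C * ?z + 1 / (4 * N) * norm u"
        using J(3)[OF C u] c(1)[OF C] N by (simp add: field_simps)
    qed
    also have "\<dots> = (\<Sum>C\<in>\<C>. 1 / c C) * ?z + real (card \<C>) / (4 * N) * norm u"
      by (simp add: sum.distrib sum_distrib_right)
    also have "real (card \<C>) / (4 * N) * norm u \<le> 1 / 4 * norm u"
      using N by (intro mult_right_mono) (auto simp: N_def field_simps)
    finally have clusters: "(\<Sum>C\<in>\<C>. norm (mul (J C) u)) \<le> (\<Sum>C\<in>\<C>. 1 / c C) * ?z + 1 / 4 * norm u"
      by simp
    have "norm (mul (indicator ?S) u) \<le> (?z + B * norm u) / (2 * \<bar>h\<bar> * real_of_int R)"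
      unfolding B_def by (rule large_coord_sum_estimate[OF u pair_pot_bound[OF I vb] h R])
    also have "\<dots> = 1 / (2 * \<bar>h\<bar> * real_of_int R) * ?z + B / (2 * \<bar>h\<bar> * real_of_int R) * norm u"
      by (simp add: add_divide_distrib)
    also have "\<dots> \<le> 1 / (2 * \<bar>h\<bar> * real_of_int R) * ?z + 1 / 4 * norm u"
      using BR by (intro add_left_mono mult_right_mono) auto
    finally show ?thesis using cover clusters unfolding K_def distrib_right distrib_left by linarith
  qed
  show ?thesis using est K F by (intro exI[of _ "2 * K"] exI[of _ F]) auto
qed

text \<open>The induction starts by itself: with at most one particle \<open>\<C>\<close> is empty,
  so the estimate is available at every \<open>t\<close> and the spectrum consists of
  eigenvalues.\<close>

theorem countable_spec_ham:
  assumes h: "h \<noteq> 0" and I: "finite I"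
    and vb: "\<And>n. \<bar>v n\<bar> \<le> b" and decay: "\<And>\<epsilon>. 0 < \<epsilon> \<Longrightarrow> \<exists>l. \<forall>n. l \<le> real_of_int \<bar>n\<bar> \<longrightarrow> \<bar>v n\<bar> \<le> \<epsilon>"
  shows "countable (spec (ham g h I (pair_pot v I)))"
  using I
proof (induction I rule: finite_psubset_induct)
  case (psubset I)
  let ?H = "ham g h I (pair_pot v I)"
  let ?P = "\<lambda>C. ham g h I (\<lambda>x. pair_pot v C x + pair_pot v (I - C) x)"
  interpret self_adjoint_graph "supp_in (conf I)" ?H by (rule self_adjoint_ham)
  define \<C> where "\<C> = {C. C \<noteq> {} \<and> C \<subset> I}"
  have fin: "finite \<C>" unfolding \<C>_def by (rule finite_subset[of _ "Pow I"]) (use psubset.hyps in auto)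
  have clusters: "countable (spec (?P C))" if "C \<in> \<C>" for C
  proof -
    have C: "C \<noteq> {}" "C \<subset> I" "I - C \<noteq> {}" "I - C \<subset> I" "C \<union> (I - C) = I" using that by (auto simp: \<C>_def)
    then have "countable (spec (ham g h (C \<union> (I - C)) (\<lambda>x. pair_pot v C x + pair_pot v (I - C) x)))"
      using psubset.hyps finite_subset[of _ I]
      by (intro spec_two_clusters h psubset.IH) auto
    then show ?thesis using C by simp
  qed
  have eig: "countable {t. \<exists>u. u \<noteq> 0 \<and> (u, t *\<^sub>R u) \<in> ?H}"
  proof (rule countable_eigenvalues[where D = "delta ` conf I"])
    show "countable (delta ` conf I)" using countable_conf[OF psubset.hyps] by simp
    show "u = 0" if u: "(u, u') \<in> ?H" "\<And>x. x \<in> delta ` conf I \<Longrightarrow> inner u x = 0" for u u'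
    proof (rule l2_eqI)
      fix x show "ap u x = ap 0 x"
      proof (cases "x \<in> conf I")
        case True
        then have "inner u (delta x) = 0" using u(2) by blast
        then show ?thesis by (metis inner_commute inner_delta ap_zero)
      qed (use in_L1[OF u(1)] in \<open>auto simp: supp_in_def\<close>)
    qed
  qed (auto intro: symm graph_scale)
  have "spec ?H \<subseteq> {t. \<exists>u. u \<noteq> 0 \<and> (u, t *\<^sub>R u) \<in> ?H} \<union> (\<Union>C\<in>\<C>. spec (?P C))"
  proof
    fix t assume t: "t \<in> spec ?H"
    show "t \<in> {t. \<exists>u. u \<noteq> 0 \<and> (u, t *\<^sub>R u) \<in> ?H} \<union> (\<Union>C\<in>\<C>. spec (?P C))"
    proof (cases "t \<in> (\<Union>C\<in>\<C>. spec (?P C))")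
      case False
      then have "regular_at (?P C) t" if "C \<noteq> {}" "C \<subset> I" for C
        using that by (auto simp: \<C>_def spec_def)
      then obtain K F where KF: "0 \<le> K" "finite F" "\<And>u u'. (u, u') \<in> ?H \<Longrightarrow>
          norm u \<le> K * norm (u' - t *\<^sub>R u) + 2 * norm (mul (indicator F) u)"
        using fredholm_estimate[OF h psubset.hyps vb decay, where g = g and t = t] by blast
      have "\<exists>u. u \<noteq> 0 \<and> (u, t *\<^sub>R u) \<in> ?H"
        by (rule eigenvalue_from_fredholm_estimate[OF self_adjoint_ham KF(2,1) _ KF(3) t]) simp
      then show ?thesis by blast
    qed blast
  qed
  moreover have "countable ({t. \<exists>u. u \<noteq> 0 \<and> (u, t *\<^sub>R u) \<in> ?H} \<union> (\<Union>C\<in>\<C>. spec (?P C)))"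
    using eig clusters countable_finite[OF fin] by (intro countable_Un countable_UN) auto
  ultimately show ?case by (rule countable_subset)
qed

section \<open>Return to complex-valued functions\<close>

lemma config_eq_conf: "config N = conf {..<N}"
  by (auto simp: config_def conf_def not_less)

text \<open>The domain condition is read off the eigenvalue equation: as
  \<open>h \<noteq> 0\<close>, the coordinate sum times \<open>u\<close> equals \<open>z\<close>,
  which is built from \<open>u\<close> by bounded operators.\<close>

lemma eigenvector_of_real:
  assumes h: "h \<noteq> 0" and vb: "\<And>n. \<bar>v n\<bar> \<le> b"
    and u: "(u, t *\<^sub>R u) \<in> ham g h {..<N} (pair_pot v {..<N})" "u \<noteq> 0"
  shows "eigenvector g h v N (\<lambda>x. complex_of_real (ap u x))"
proof -
  let ?I = "{..<N}" and ?\<psi> = "\<lambda>x. complex_of_real (ap u x)"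
  have eq: "t * ap u x = ap (hop g ?I u) x + (pair_pot v ?I x - 2 * h * coord_sum ?I x) * ap u x" for x
    using u(1) by (simp add: ham_def)
  have supp: "ap u x = 0" if "x \<notin> config N" for x
    using u(1) that by (simp add: ham_def supp_in_def config_eq_conf)
  have bW: "bounded (range (pair_pot v ?I))"
    using pair_pot_bound[of ?I v b, OF _ vb] by (auto intro!: boundedI)
  define z where "z = (1 / (2 * h)) *\<^sub>R (hop g ?I u + mul (pair_pot v ?I) u - t *\<^sub>R u)"
  have z: "ap z x = coord_sum ?I x * ap u x" for x
  proof -
    have "ap (hop g ?I u) x + pair_pot v ?I x * ap u x - t * ap u x = 2 * h * (coord_sum ?I x * ap u x)"
      using eq[of x] by (simp add: algebra_simps)
    then show ?thesis using h by (simp add: z_def ap_mul[OF bW])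
  qed
  have "?\<psi> \<in> ell2 N" using supp ap_summable[of u] by (simp add: ell2_def)
  moreover have "(\<lambda>x. of_int (\<Sum>k<N. x k) * ?\<psi> x) \<in> ell2 N"
  proof -
    have "(\<lambda>x. of_int (\<Sum>k<N. x k) * ?\<psi> x) = (\<lambda>x. complex_of_real (ap z x))"
      by (rule ext) (simp add: z coord_sum_def)
    moreover have "(\<lambda>x. complex_of_real (ap z x)) \<in> ell2 N"
      using supp ap_summable[of z] by (simp add: ell2_def) (simp add: z)
    ultimately show ?thesis by simp
  qed
  ultimately have "?\<psi> \<in> domH N" by (simp add: domH_def)
  moreover have "?\<psi> \<noteq> (\<lambda>_. 0)"
  proof
    assume "?\<psi> = (\<lambda>_. 0)"
    then have "ap u x = 0" for x by (metis of_real_eq_0_iff)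
    then have "u = 0" by (intro l2_eqI) simp
    with u(2) show False by blast
  qed
  moreover have "Hop g h v N ?\<psi> x = of_real t * ?\<psi> x" for x
  proof (cases "x \<in> config N")
    case True
    have int: "?I \<inter> {i<..} = {i<..<N}" for i by auto
    have "Hop g h v N ?\<psi> x
        = of_real (ap (hop g ?I u) x + (pair_pot v ?I x - 2 * h * coord_sum ?I x) * ap u x)"
      using True by (simp add: Hop_def ap_hop pair_pot_def coord_sum_def int algebra_simps)
    also have "\<dots> = of_real t * ?\<psi> x" by (simp flip: eq)
    finally show ?thesis .
  next
    case False
    then show ?thesis by (simp add: Hop_def supp)
  qed
  ultimately show ?thesis unfolding eigenvector_def by blast
qed

lemma l2_of_bounded_by_ell2:
  assumes "\<phi> \<in> ell2 N" "\<And>x. \<bar>f x\<bar> \<le> cmod (\<phi> x)"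
  obtains r where "\<And>x. ap r x = f x" "r \<in> supp_in (conf {..<N})"
proof -
  have "(\<lambda>x. (f x)\<^sup>2) summable_on UNIV"
  proof (rule nonneg_summable_on_le)
    show "(\<lambda>x. (cmod (\<phi> x))\<^sup>2) summable_on UNIV" using assms(1) by (simp add: ell2_def)
    show "(f x)\<^sup>2 \<le> (cmod (\<phi> x))\<^sup>2" for x using assms(2)[of x] by (simp add: abs_le_square_iff[symmetric])
  qed simp
  then have r: "ap (Abs_l2 f) = f" by (intro Abs_l2_inverse) simp
  moreover have "f x = 0" if "x \<notin> conf {..<N}" for x
    using assms(1) assms(2)[of x] that by (auto simp: ell2_def config_eq_conf)
  ultimately show ?thesis by (intro that[of "Abs_l2 f"]) (auto simp: supp_in_def)
qed

lemma span_approximation: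
  fixes E :: "'a::real_normed_vector set"
  assumes "x \<in> closure (span E)" "0 < e"
  obtains T c where "finite T" "T \<subseteq> E" "norm (x - (\<Sum>u\<in>T. c u *\<^sub>R u)) < e"
proof -
  obtain s where s: "s \<in> span E" "dist s x < e" using assms unfolding closure_approachable by blast
  then obtain T c where "finite T" "T \<subseteq> E" "s = (\<Sum>u\<in>T. c u *\<^sub>R u)" by (auto simp: span_explicit)
  with s(2) show ?thesis by (intro that[of T c]) (auto simp: dist_norm norm_minus_commute)
qed

theorem theorem1:
  fixes g h :: real and N :: nat and v :: "int \<Rightarrow> real"
  assumes "h \<noteq> 0" and "N \<ge> 1"
    and "bounded (range v)"
    and "(v \<longlongrightarrow> 0) at_top" and "(v \<longlongrightarrow> 0) at_bot"
  shows "pure_point g h v N"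
proof -
  let ?I = "{..<N}"
  let ?H = "ham g h ?I (pair_pot v ?I)"
  interpret self_adjoint_graph "supp_in (conf ?I)" ?H by (rule self_adjoint_ham)
  obtain b where b: "\<And>n. \<bar>v n\<bar> \<le> b" using assms(3) by (auto simp: bounded_iff)
  have decay: "\<exists>l. \<forall>n. l \<le> real_of_int \<bar>n\<bar> \<longrightarrow> \<bar>v n\<bar> \<le> \<epsilon>" if \<epsilon>: "0 < \<epsilon>" for \<epsilon>
  proof -
    obtain p where p: "\<And>n. p \<le> n \<Longrightarrow> \<bar>v n\<bar> < \<epsilon>"
      using tendstoD[OF assms(4) \<epsilon>] by (auto simp: eventually_at_top_linorder)
    obtain q where q: "\<And>n. n \<le> q \<Longrightarrow> \<bar>v n\<bar> < \<epsilon>"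
      using tendstoD[OF assms(5) \<epsilon>] by (auto simp: eventually_at_bot_linorder)
    \<comment> \<open>From \<open>\<bar>p\<bar> + \<bar>q\<bar>\<close> on, \<open>n\<close> lies
      either above \<open>p\<close> or below \<open>q\<close>, so one of the two limits
      applies.\<close>
    have "\<bar>v n\<bar> \<le> \<epsilon>" if "real_of_int (\<bar>p\<bar> + \<bar>q\<bar>) \<le> real_of_int \<bar>n\<bar>" for n
    proof -
      have "p \<le> n \<or> n \<le> q" using that by linarith
      then show ?thesis using p q by (auto intro: less_imp_le)
    qed
    then show ?thesis by blast
  qed
  define E where "E = eigenvecs ?H - {0}"
  have total: "supp_in (conf ?I) \<subseteq> closure (span E)"
    using eigenvectors_total[OF countable_spec_ham[OF assms(1) finite_lessThan b decay]]
    by (simp add: E_def)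
  show ?thesis
    unfolding pure_point_def
  proof (intro ballI allI impI)
    fix \<phi> and \<epsilon> :: real
    assume \<phi>: "\<phi> \<in> ell2 N" and \<epsilon>: "0 < \<epsilon>"
    obtain r1 where r1: "\<And>x. ap r1 x = Re (\<phi> x)" "r1 \<in> supp_in (conf ?I)"
      using l2_of_bounded_by_ell2[OF \<phi>, of "\<lambda>x. Re (\<phi> x)"] abs_Re_le_cmod by blast
    obtain r2 where r2: "\<And>x. ap r2 x = Im (\<phi> x)" "r2 \<in> supp_in (conf ?I)"
      using l2_of_bounded_by_ell2[OF \<phi>, of "\<lambda>x. Im (\<phi> x)"] abs_Im_le_cmod by blast
    have \<epsilon>2: "0 < \<epsilon> / 2" using \<epsilon> by simp
    obtain T1 c1 where T1: "finite T1" "T1 \<subseteq> E" "norm (r1 - (\<Sum>u\<in>T1. c1 u *\<^sub>R u)) < \<epsilon> / 2"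
      using span_approximation[OF subsetD[OF total r1(2)] \<epsilon>2] by blast
    obtain T2 c2 where T2: "finite T2" "T2 \<subseteq> E" "norm (r2 - (\<Sum>u\<in>T2. c2 u *\<^sub>R u)) < \<epsilon> / 2"
      using span_approximation[OF subsetD[OF total r2(2)] \<epsilon>2] by blast
    define s1 where "s1 = (\<Sum>u\<in>T1. c1 u *\<^sub>R u)"
    define s2 where "s2 = (\<Sum>u\<in>T2. c2 u *\<^sub>R u)"
    define T where "T = T1 \<union> T2"
    have T: "finite T" using T1(1) T2(1) by (simp add: T_def)
    \<comment> \<open>Real and imaginary parts are approximated separately; the default 0 lets both
      combinations run over the common set \<open>T\<close>.\<close>
    define d where "d u = Complex (if u \<in> T1 then c1 u else 0) (if u \<in> T2 then c2 u else 0)" for u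
    define emb where "emb u = (\<lambda>x. complex_of_real (ap u x))" for u :: "(nat \<Rightarrow> int) l2"
    \<comment> \<open>The coefficients in \<open>pure_point\<close> are indexed by complex
      functions, so they are read back through \<open>inv emb\<close>.\<close>
    have inj: "inj emb"
      by (rule injI, rule l2_eqI) (metis emb_def of_real_eq_iff)
    have "(\<Sum>u\<in>T. d u * emb u x) = Complex (ap s1 x) (ap s2 x)" for x
    proof -
      have "Re (\<Sum>u\<in>T. d u * emb u x) = (\<Sum>u\<in>T. (if u \<in> T1 then c1 u else 0) * ap u x)"
        by (simp add: d_def emb_def)
      also have "\<dots> = ap s1 x"
        unfolding s1_def ap_sum using T by (intro sum.mono_neutral_cong_right) (auto simp: T_def)
      finally have 1: "Re (\<Sum>u\<in>T. d u * emb u x) = ap s1 x" .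
      have "Im (\<Sum>u\<in>T. d u * emb u x) = (\<Sum>u\<in>T. (if u \<in> T2 then c2 u else 0) * ap u x)"
        by (simp add: d_def emb_def)
      also have "\<dots> = ap s2 x"
        unfolding s2_def ap_sum using T by (intro sum.mono_neutral_cong_right) (auto simp: T_def)
      finally show ?thesis using 1 by (simp add: complex_eq_iff)
    qed
    then have sum: "(\<Sum>\<psi>\<in>emb ` T. d (inv emb \<psi>) * \<psi> x) = Complex (ap s1 x) (ap s2 x)" for x
      using inj by (subst sum.reindex) (auto intro: inj_on_subset)
    have "ell2_norm (\<lambda>x. \<phi> x - (\<Sum>\<psi>\<in>emb ` T. d (inv emb \<psi>) * \<psi> x)) < \<epsilon>"
    proof -
      have "(cmod (\<phi> x - Complex (ap s1 x) (ap s2 x)))\<^sup>2 = (ap (r1 - s1) x)\<^sup>2 + (ap (r2 - s2) x)\<^sup>2" for x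
        by (simp add: cmod_power2 r1 r2)
      then have "ell2_norm (\<lambda>x. \<phi> x - (\<Sum>\<psi>\<in>emb ` T. d (inv emb \<psi>) * \<psi> x))
          = sqrt (\<Sum>\<^sub>\<infinity>x. (ap (r1 - s1) x)\<^sup>2 + (ap (r2 - s2) x)\<^sup>2)"
        by (simp only: ell2_norm_def sum)
      also have "\<dots> = sqrt ((norm (r1 - s1))\<^sup>2 + (norm (r2 - s2))\<^sup>2)"
        by (simp only: infsum_add ap_summable norm_l2_sq)
      also have "\<dots> \<le> norm (r1 - s1) + norm (r2 - s2)" by (rule sqrt_sum_squares_le_sum) simp_all
      also have "\<dots> < \<epsilon>" using T1(3) T2(3) by (simp add: s1_def s2_def)
      finally show ?thesis .
    qed
    moreover have "eigenvector g h v N \<psi>" if "\<psi> \<in> emb ` T" for \<psi>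
    proof -
      obtain u where "u \<in> E" "\<psi> = emb u" using \<open>\<psi> \<in> emb ` T\<close> T1(2) T2(2) by (auto simp: T_def)
      then show ?thesis
        unfolding emb_def E_def eigenvecs_def by (auto intro: eigenvector_of_real[OF assms(1) b])
    qed
    ultimately show "\<exists>F c. finite F \<and> (\<forall>\<psi>\<in>F. eigenvector g h v N \<psi>) \<and>
        ell2_norm (\<lambda>x. \<phi> x - (\<Sum>\<psi>\<in>F. c \<psi> * \<psi> x)) < \<epsilon>"
      using T by (intro exI[of _ "emb ` T"] exI[of _ "\<lambda>\<psi>. d (inv emb \<psi>)"]) auto
  qed
qed

end
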